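(* Let $\{X_t: t\ge 0\}$ be a purely non-Gaussian $d$-dimensional Lévy process with $X_0=0$ and Lévy measure $\Pi$. Let $\lambda\ge0$, let $q\in[0,1]$ and $h\in\mathcal{H}_q$, and let $b(t)=\sqrt{t\log\log(1/t)}/h(1/t)$ for all sufficiently small $t>0$. Assume that $$\limsup_{t\downarrow0}V(b(t))\,h^2(1/t)\ge\lambda^2/2.$$ Then with probability one, $$\limsup_{t\downarrow0}h(1/t)\frac{|X_t|}{\sqrt{t\log\log(1/t)}}\ge(1-q)^{1/2}\lambda.$$
   Context: A $d$-dimensional Lévy process with $X_0=0$ has characteristic triplet $(\gamma,\Sigma,\Pi)$ with $\gamma\in\mathbb{R}^d$, $\Sigma$ symmetric non-negative definite and $\Pi$ a Lévy measure on $\mathbb{R}^d$ ($\Pi(\{0\})=0$, $\int(1\wedge|y|^2)\Pi(dy)<\infty$); it is purely non-Gaussian if $\Sigma=0$. $|\cdot|$ is the Euclidean norm, $\langle\cdot,\cdot\rangle$ the inner product. $V(t)=\sup_{|z|\le1}\int_{|y|\le t}\langle y,z\rangle^2\,\Pi(dy)$, $t\ge0$. $\mathcal{H}_1$ is the class of continuous non-decreasing functions $h:[0,\infty)\to[0,\infty)$ slowly varying at infinity. With $f_\tau(x)=\exp((\log x)^\tau)$, $x\ge1$, for $0\le q<1$ the class $\mathcal{H}_q$ consists of those $h\in\mathcal{H}_1$ with $h(xf_\tau(x))/h(x)\to1$ as $x\to\infty$ for every $0\le\tau<1-q$. *)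

theory Defs
  imports "HOL-Probability.Probability"
begin

definition levy_measure :: "(real^'n) measure \<Rightarrow> bool" where
  "levy_measure Lm \<longleftrightarrow>
     sets Lm = sets borel \<and>
     emeasure Lm {0} = 0 \<and>
     (\<integral>\<^sup>+ y. ennreal (min 1 (norm y ^ 2)) \<partial>Lm) < \<infinity>"

definition levy_exponent ::
  "real^'n \<Rightarrow> real^'n^'n \<Rightarrow> (real^'n) measure \<Rightarrow> real^'n \<Rightarrow> complex" where
  "levy_exponent \<gamma> \<Sigma> Lm z =
     \<i> * complex_of_real (\<gamma> \<bullet> z)
     - complex_of_real ((z \<bullet> (\<Sigma> *v z)) / 2)
     + integral\<^sup>L Lm (\<lambda>y. exp (\<i> * complex_of_real (z \<bullet> y)) - 1
                       - \<i> * complex_of_real (z \<bullet> y) * complex_of_real (indicator (cball 0 1) y))"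

definition levy_process ::
  "'w measure \<Rightarrow> (real \<Rightarrow> 'w \<Rightarrow> real^'n) \<Rightarrow> real^'n \<Rightarrow> real^'n^'n \<Rightarrow> (real^'n) measure \<Rightarrow> bool" where
  "levy_process M X \<gamma> \<Sigma> Lm \<longleftrightarrow>
     prob_space M \<and>
     transpose \<Sigma> = \<Sigma> \<and> (\<forall>z. 0 \<le> z \<bullet> (\<Sigma> *v z)) \<and>
     levy_measure Lm \<and>
     (\<forall>t\<ge>0. X t \<in> borel_measurable M) \<and>
     (\<forall>\<omega>\<in>space M. X 0 \<omega> = 0) \<and>
     (\<forall>(n::nat) (ts::nat \<Rightarrow> real). 0 \<le> ts 0 \<and> (\<forall>i<n. ts i \<le> ts (Suc i)) \<longrightarrow>
        prob_space.indep_vars M (\<lambda>_. borel) (\<lambda>i \<omega>. X (ts (Suc i)) \<omega> - X (ts i) \<omega>) {..<n}) \<and>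
     (\<forall>s t. 0 \<le> s \<and> 0 \<le> t \<longrightarrow>
        distr M borel (\<lambda>\<omega>. X (s + t) \<omega> - X s \<omega>) = distr M borel (X t)) \<and>
     (AE \<omega> in M. \<forall>t\<ge>0. continuous (at_right t) (\<lambda>s. X s \<omega>) \<and>
                          (t > 0 \<longrightarrow> (\<exists>l. ((\<lambda>s. X s \<omega>) \<longlongrightarrow> l) (at_left t)))) \<and>
     (\<forall>t\<ge>0. \<forall>z. integral\<^sup>L M (\<lambda>\<omega>. exp (\<i> * complex_of_real (z \<bullet> X t \<omega>)))
                 = exp (complex_of_real t * levy_exponent \<gamma> \<Sigma> Lm z))"

definition V_fun :: "(real^'n) measure \<Rightarrow> real \<Rightarrow> real" where
  "V_fun Lm t = (SUP z\<in>cball (0::real^'n) 1. (LINT y:cball 0 t|Lm. (y \<bullet> z)^2))"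

definition slowly_varying :: "(real \<Rightarrow> real) \<Rightarrow> bool" where
  "slowly_varying h \<longleftrightarrow> (\<forall>c>0. ((\<lambda>x. h (c * x) / h x) \<longlongrightarrow> 1) at_top)"

definition class_H1 :: "(real \<Rightarrow> real) \<Rightarrow> bool" where
  "class_H1 h \<longleftrightarrow> continuous_on {0..} h \<and> mono_on {0..} h \<and>
     (\<forall>x\<ge>0. 0 \<le> h x) \<and> slowly_varying h"

definition f_tau :: "real \<Rightarrow> real \<Rightarrow> real" where
  "f_tau \<tau> x = exp ((ln x) powr \<tau>)"

text \<open>For q < 1 this is the class H_q of the paper; for q = 1 the extra condition
  is vacuous and the definition coincides with H_1.\<close>
definition class_H :: "real \<Rightarrow> (real \<Rightarrow> real) \<Rightarrow> bool" where
  "class_H q h \<longleftrightarrow> class_H1 h \<and>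
     (\<forall>\<tau>. 0 \<le> \<tau> \<and> \<tau> < 1 - q \<longrightarrow> ((\<lambda>x. h (x * f_tau \<tau> x) / h x) \<longlongrightarrow> 1) at_top)"

end

theory Submission
  imports Defs "HOL-Real_Asymp.Real_Asymp"
begin

text \<open>Fix \<open>c < \<lambda> (1 - q)\<^sup>1\<^sup>/\<^sup>2\<close> and a small \<open>t\<close> at which \<open>V (b t) h\<^sup>2 (1/t)\<close> is close to its limit superior. Consider
  the geometric times \<open>s\<close> in the upper half, on the logarithmic scale, of \<open>[t, t exp (ln (1/t)\<^sup>\<sigma>)]\<close> with
  \<open>\<sigma> < 1 - q\<close>. There \<open>h (1/s)\<close> is comparable with \<open>h (1/t)\<close>, and the jumps of size at most \<open>b t\<close>,
  which carry the variance \<open>V (b t)\<close>, are so small compared with \<open>b s\<close> that this part of the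
  process is Gaussian on the scale of \<open>b s\<close>, in both tails. Whatever value the independent rest
  (the other jumps and the drift) takes, one of these tails suffices, so the increment ending at
  \<open>s\<close> exceeds \<open>c b s\<close> with probability at least \<open>ln (1/t)\<^sup>-\<^sup>\<kappa>\<close>, where \<open>\<kappa>\<close> can be taken less than \<open>\<sigma>\<close>. As there are of order
  \<open>ln (1/t)\<^sup>\<sigma>\<close> independent increments, one of them is large with probability tending to one, and
  for a large ratio of successive times the process itself is then large at one of its end points.\<close>

section \<open>Compound Poisson laws\<close>

text \<open>In a suitable direction the increment ending at \<open>s\<close> keeps a variance close
  to \<open>s * \<lambda>^2 / (2 * h (1/t)^2)\<close>, so the Gaussian exponent at level
  \<open>c * b s\<close> is about \<open>(c^2 / \<lambda>^2) * ln (ln (1/s))\<close>. This explains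
  the factor 1/2 in the assumption on \<open>V\<close>, and
  \<open>c^2 < (1 - q) * \<lambda>^2\<close> leaves room for the exponents of the block. The good
  times \<open>t\<close> come with no control on their spacing, and different blocks are never
  compared: arbitrarily close to 0 a single block succeeds with probability as near to one as
  desired, and this already forces the almost sure statement. The law of the process is given
  through its characteristic exponent, so the jumps are separated at the level of laws, as factors
  of a convolution, and not along the paths.\<close>

lemma real_distribution_convolution:
  assumes "real_distribution M" "real_distribution N"
  shows "real_distribution (M \<star> N)"
proof -
  interpret M: real_distribution M by fact
  interpret N: real_distribution N by fact
  interpret P: pair_prob_space M N ..
  have "prob_space (M \<star> N)"
    unfolding convolution_def by (rule P.prob_space_distr) simp
  then show ?thesis
    by (simp add: real_distribution_def real_distribution_axioms_def)
qed

lemma char_convolution: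
  assumes "real_distribution M" "real_distribution N"
  shows "char (M \<star> N) t = char M t * char N t"
proof -
  interpret M: real_distribution M by fact
  interpret N: real_distribution N by fact
  interpret P: pair_prob_space M N ..
  have int: "integrable (M \<Otimes>\<^sub>M N) (\<lambda>(x, y). iexp (t * x) * iexp (t * y))"
    by (rule P.integrable_const_bound[where B=1]) (auto simp: norm_mult)
  have "char (M \<star> N) t = (CLINT p|M \<Otimes>\<^sub>M N. (case p of (x, y) \<Rightarrow> iexp (t * x) * iexp (t * y)))"
    unfolding char_def convolution_def
    by (subst integral_distr) (auto simp: case_prod_beta' distrib_left exp_add)
  also have "\<dots> = (CLINT x|M. CLINT y|N. iexp (t * x) * iexp (t * y))"
    using P.integral_fst[OF int] by (simp add: case_prod_beta')
  also have "\<dots> = char M t * char N t"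
    by (simp add: char_def)
  finally show ?thesis .
qed

text \<open>Nonnegative integrals make exponential moments multiplicative with no integrability to
  carry through the convolution powers.\<close>

lemma nn_integral_exp_convolution:
  fixes s :: real
  assumes "real_distribution M" "real_distribution N"
  shows "(\<integral>\<^sup>+x. ennreal (exp (s * x)) \<partial>(M \<star> N)) =
    (\<integral>\<^sup>+x. ennreal (exp (s * x)) \<partial>M) * (\<integral>\<^sup>+x. ennreal (exp (s * x)) \<partial>N)"
proof -
  interpret M: real_distribution M by fact
  interpret N: real_distribution N by fact
  have "(\<integral>\<^sup>+x. ennreal (exp (s * x)) \<partial>(M \<star> N)) =
      (\<integral>\<^sup>+x. \<integral>\<^sup>+y. ennreal (exp (s * x)) * ennreal (exp (s * y)) \<partial>N \<partial>M)"
    by (subst nn_integral_convolution)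
      (auto simp: distrib_left exp_add ennreal_mult M.finite_measure_axioms N.finite_measure_axioms)
  also have "\<dots> = (\<integral>\<^sup>+x. ennreal (exp (s * x)) * (\<integral>\<^sup>+y. ennreal (exp (s * y)) \<partial>N) \<partial>M)"
    by (intro nn_integral_cong nn_integral_cmult) simp
  also have "\<dots> = (\<integral>\<^sup>+x. ennreal (exp (s * x)) \<partial>M) * (\<integral>\<^sup>+y. ennreal (exp (s * y)) \<partial>N)"
    by (rule nn_integral_multc) simp
  finally show ?thesis .
qed

primrec convolution_power :: "real measure \<Rightarrow> nat \<Rightarrow> real measure" where
  "convolution_power N 0 = return borel 0"
| "convolution_power N (Suc k) = (N \<star> convolution_power N k)"

lemma real_distribution_return: "real_distribution (return borel (x::real))"
  by (auto simp: real_distribution_def real_distribution_axioms_def intro!: prob_space_return)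

lemma real_distribution_convolution_power:
  "real_distribution N \<Longrightarrow> real_distribution (convolution_power N k)"
  by (induction k) (auto intro: real_distribution_convolution real_distribution_return)

lemma char_return: "char (return borel x) t = iexp (t * x)"
  unfolding char_def by (subst integral_return) auto

lemma char_convolution_power:
  "real_distribution N \<Longrightarrow> char (convolution_power N k) t = char N t ^ k"
  by (induction k) (auto simp: char_return char_convolution real_distribution_convolution_power)

lemma nn_integral_exp_convolution_power:
  fixes s :: real
  shows "real_distribution N \<Longrightarrow>
    (\<integral>\<^sup>+x. ennreal (exp (s * x)) \<partial>convolution_power N k) = (\<integral>\<^sup>+x. ennreal (exp (s * x)) \<partial>N) ^ k"
  by (induction k)
    (auto simp: nn_integral_return nn_integral_exp_convolution real_distribution_convolution_power)

text \<open>The Poisson generating function, twice: here on the nonnegative reals for exponential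
  moments, in the next lemma on the closed complex unit disc for characteristic functions.\<close>

lemma nn_integral_power_poisson_pmf:
  fixes m r :: real
  assumes "0 < m" "0 \<le> r"
  shows "(\<integral>\<^sup>+k. ennreal r ^ k \<partial>poisson_pmf m) = ennreal (exp (m * (r - 1)))"
proof -
  have sums: "(\<lambda>k. m ^ k / fact k * exp (- m) * r ^ k) sums (exp (m * r) * exp (- m))"
    using sums_mult2[OF exp_converges[of "m * r"], of "exp (- m)"]
    by (simp add: power_mult_distrib field_simps)
  have "(\<integral>\<^sup>+k. ennreal r ^ k \<partial>poisson_pmf m) =
      (\<Sum>k. ennreal (m ^ k / fact k * exp (- m) * r ^ k))"
    using assms by (auto simp: nn_integral_measure_pmf nn_integral_count_space_nat
      ennreal_power ennreal_mult[symmetric] intro!: suminf_cong)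
  also have "\<dots> = ennreal (exp (m * r) * exp (- m))"
    using assms by (intro suminf_ennreal_eq sums) auto
  finally show ?thesis
    by (simp add: exp_add[symmetric] algebra_simps)
qed

lemma integral_power_poisson_pmf:
  fixes m :: real and w :: complex
  assumes "0 < m" "norm w \<le> 1"
  shows "(\<integral>k. w ^ k \<partial>poisson_pmf m) = exp (of_real m * (w - 1))"
proof -
  have sums: "(\<lambda>k. complex_of_real (m ^ k / fact k * exp (- m)) * w ^ k) sums
      (exp (of_real m * w) * of_real (exp (- m)))"
    using sums_mult2[OF exp_converges[of "of_real m * w"], of "of_real (exp (- m))"]
    by (simp add: power_mult_distrib scaleR_conv_of_real field_simps)
  have sums': "(\<lambda>k. m ^ k / fact k * exp (- m)) sums (exp m * exp (- m))"
    using sums_mult2[OF exp_converges[of m], of "exp (- m)"] by (simp add: field_simps)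
  have "summable (\<lambda>k. norm ((m ^ k / fact k * exp (- m)) *\<^sub>R w ^ k))"
  proof (rule summable_comparison_test'[OF sums_summable[OF sums']])
    fix k :: nat
    have "norm w ^ k \<le> 1" using assms by (simp add: power_le_one)
    then show "norm (norm ((m ^ k / fact k * exp (- m)) *\<^sub>R w ^ k)) \<le> m ^ k / fact k * exp (- m)"
      using assms mult_left_le[of "norm w ^ k" "m ^ k / fact k * exp (- m)"]
      by (simp add: norm_mult norm_power)
  qed
  then have int: "integrable (count_space UNIV) (\<lambda>k. (m ^ k / fact k * exp (- m)) *\<^sub>R w ^ k)"
    by (simp add: integrable_count_space_nat_iff)
  have "(\<integral>k. w ^ k \<partial>poisson_pmf m) = (\<integral>k. (m ^ k / fact k * exp (- m)) *\<^sub>R w ^ k \<partial>count_space UNIV)"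
    unfolding measure_pmf_eq_density using assms by (subst integral_density) auto
  also have "\<dots> = (\<Sum>k. (m ^ k / fact k * exp (- m)) *\<^sub>R w ^ k)"
    using int by (rule integral_count_space_nat)
  also have "\<dots> = exp (of_real m * w) * of_real (exp (- m))"
    using sums_unique[OF sums] by (simp add: scaleR_conv_of_real)
  also have "\<dots> = exp (of_real m * (w - 1))"
    by (simp add: exp_of_real[symmetric] exp_add[symmetric] algebra_simps)
  finally show ?thesis .
qed

text \<open>With total mass \<open>m\<close>, the law is that of a sum of a
  Poisson(\<open>m\<close>) number of independent jumps distributed as \<open>N / m\<close>,
  realised as a Poisson mixture of convolution powers. Both transforms then come from the Poisson
  generating function, evaluated at the transform of one jump. Zero mass, where \<open>N / m\<close>
  makes no sense, gives the point mass at 0.\<close>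

lemma compound_poisson_exists:
  fixes N :: "real measure"
  assumes "finite_measure N" and [measurable_cong]: "sets N = sets borel"
  obtains D where "real_distribution D"
    and "\<And>t. char D t = exp (CLINT x|N. (iexp (t * x) - 1))"
    and "\<And>s. integrable N (\<lambda>x. exp (s * x)) \<Longrightarrow>
      (\<integral>\<^sup>+x. ennreal (exp (s * x)) \<partial>D) = ennreal (exp (\<integral>x. (exp (s * x) - 1) \<partial>N))"
proof -
  interpret N: finite_measure N by fact
  have spN: "space N = UNIV" using sets_eq_imp_space_eq[OF assms(2)] by simp
  define m where "m = measure N UNIV"
  show thesis
  proof (cases "m = 0")
    case True
    then have N0: "N = null_measure borel"
      by (intro measure_eqI) (auto simp: assms(2) m_def N.emeasure_eq_measure spN
          intro!: antisym[OF order_trans[OF N.finite_measure_mono[of _ UNIV]]])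
    show thesis
      by (rule that[of "return borel 0"])
        (auto simp: N0 char_return nn_integral_return real_distribution_return)
  next
    case False
    then have m: "m > 0" by (simp add: m_def zero_less_measure_iff spN N.emeasure_eq_measure)
    define \<mu> where "\<mu> = density N (\<lambda>_. ennreal (1 / m))"
    have "emeasure \<mu> UNIV = 1"
      using m by (simp add: \<mu>_def emeasure_density assms(2) N.emeasure_eq_measure
          spN m_def flip: ennreal_mult)
    then have \<mu>: "real_distribution \<mu>"
      by (auto simp: real_distribution_def real_distribution_axioms_def \<mu>_def spN assms(2)
          intro!: prob_spaceI)
    interpret \<mu>: real_distribution \<mu> by fact
    define D where "D = measure_pmf (poisson_pmf m) \<bind> convolution_power \<mu>"
    have K: "convolution_power \<mu> \<in> measurable (measure_pmf (poisson_pmf m)) (prob_algebra borel)"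
      using real_distribution_convolution_power[OF \<mu>]
      by (auto simp: space_prob_algebra real_distribution_def real_distribution_axioms_def)
    have P: "measure_pmf (poisson_pmf m) \<in> space (prob_algebra (measure_pmf (poisson_pmf m)))"
      by (auto simp: space_prob_algebra prob_space_measure_pmf)
    have D: "real_distribution D"
      using prob_space_bind'[OF P K] sets_bind'[OF P K]
      by (auto simp: real_distribution_def real_distribution_axioms_def D_def)
    have K': "convolution_power \<mu> \<in> measurable (measure_pmf (poisson_pmf m)) (subprob_algebra borel)"
      by (rule measurable_prob_algebraD[OF K])
    show thesis
    proof (rule that[OF D])
      fix t
      have "char D t = (\<integral>k. char (convolution_power \<mu> k) t \<partial>poisson_pmf m)"
      proof -
        interpret D: real_distribution D by (rule D)
        have C: "real_distribution (convolution_power \<mu> k)" for k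
          by (rule real_distribution_convolution_power[OF \<mu>])
        have iC: "integrable (convolution_power \<mu> k) (\<lambda>x. iexp (t * x))" for k
        proof -
          interpret real_distribution "convolution_power \<mu> k" by (rule C)
          show ?thesis by (intro integrable_iexp) auto
        qed
        have iD: "integrable D (\<lambda>x. iexp (t * x))"
          by (intro D.integrable_iexp) auto
        have iP: "integrable (poisson_pmf m) (\<lambda>k. char (convolution_power \<mu> k) t)"
          using real_distribution.cmod_char_le_1[OF C]
          by (intro measure_pmf.integrable_const_bound[where B=1]) auto
        have E1: "AE k in poisson_pmf m. emeasure (convolution_power \<mu> k) (space (convolution_power \<mu> k)) \<le> ennreal 1"
          using C by (auto simp: real_distribution_def prob_space.emeasure_space_1)
        \<comment> \<open>The exchange of integrals is made for bounded real integrands, so the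
          characteristic function is treated through its real and imaginary parts.\<close>
        have "(\<integral>x. Re (iexp (t * x)) \<partial>D) = (\<integral>k. (\<integral>x. Re (iexp (t * x)) \<partial>convolution_power \<mu> k) \<partial>poisson_pmf m)"
          unfolding D_def
          by (rule integral_bind[where K=borel and B=1 and B'=1, OF _ _ K' _ E1])
            (auto intro: measure_pmf.finite_measure_axioms order_trans[OF abs_Re_le_cmod])
        moreover have "(\<integral>x. Im (iexp (t * x)) \<partial>D) = (\<integral>k. (\<integral>x. Im (iexp (t * x)) \<partial>convolution_power \<mu> k) \<partial>poisson_pmf m)"
          unfolding D_def
          by (rule integral_bind[where K=borel and B=1 and B'=1, OF _ _ K' _ E1])
            (auto intro: measure_pmf.finite_measure_axioms order_trans[OF abs_Im_le_cmod])
        ultimately show ?thesis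
          using integral_Re[OF iD] integral_Im[OF iD] integral_Re[OF iC] integral_Im[OF iC]
            integral_Re[OF iP] integral_Im[OF iP]
          by (simp add: char_def complex_eq_iff del: integral_Re integral_Im)
      qed
      also have "\<dots> = exp (of_real m * (char \<mu> t - 1))"
        by (simp add: char_convolution_power[OF \<mu>] integral_power_poisson_pmf[OF m \<mu>.cmod_char_le_1])
      also have "of_real m * (char \<mu> t - 1) = (CLINT x|N. (iexp (t * x) - 1))"
      proof -
        have int: "integrable N (\<lambda>x. iexp (t * x))"
          by (rule N.integrable_const_bound[where B=1]) auto
        have "char \<mu> t = (1 / m) *\<^sub>R (CLINT x|N. iexp (t * x))"
          unfolding char_def \<mu>_def using m by (subst integral_density) auto
        then show ?thesis
          using m int by (simp add: scaleR_conv_of_real field_simps m_def spN)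
      qed
      finally show "char D t = exp (CLINT x|N. (iexp (t * x) - 1))" .
    next
      fix s assume int: "integrable N (\<lambda>x. exp (s * x))"
      define r where "r = (\<integral>x. exp (s * x) \<partial>N) / m"
      have "r \<ge> 0" using m by (simp add: r_def)
      have "(\<integral>\<^sup>+x. ennreal (exp (s * x)) \<partial>\<mu>) = ennreal (1 / m) * (\<integral>\<^sup>+x. ennreal (exp (s * x)) \<partial>N)"
        unfolding \<mu>_def by (subst nn_integral_density) (auto simp: nn_integral_cmult)
      also have "\<dots> = ennreal r"
        using m int by (subst nn_integral_eq_integral) (auto simp: r_def ennreal_mult[symmetric])
      finally have r: "(\<integral>\<^sup>+x. ennreal (exp (s * x)) \<partial>\<mu>) = ennreal r" .
      have "(\<integral>\<^sup>+x. ennreal (exp (s * x)) \<partial>D) =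
          (\<integral>\<^sup>+k. \<integral>\<^sup>+x. ennreal (exp (s * x)) \<partial>convolution_power \<mu> k \<partial>poisson_pmf m)"
        unfolding D_def by (rule nn_integral_bind[OF _ K']) simp
      also have "\<dots> = ennreal (exp (m * (r - 1)))"
        using m \<open>r \<ge> 0\<close>
        by (simp add: nn_integral_exp_convolution_power[OF \<mu>] r nn_integral_power_poisson_pmf)
      also have "m * (r - 1) = (\<integral>x. (exp (s * x) - 1) \<partial>N)"
        using m int by (simp add: r_def field_simps m_def spN)
      finally show "(\<integral>\<^sup>+x. ennreal (exp (s * x)) \<partial>D) = ennreal (exp (\<integral>x. (exp (s * x) - 1) \<partial>N))" .
    qed
  qed
qed

section \<open>A lower bound for tails by exponential tilting\<close>

text \<open>Under the law tilted by \<open>exp (s x)\<close> the mass concentrates on \<open>[a, b]\<close>: Chernoff bounds with the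
  exponents \<open>s - h\<close> and \<open>s + h\<close> discard what lies outside.\<close>

lemma mgf_tail_lower_bound:
  fixes D :: "real measure" and a v \<kappa> :: real and K :: "real \<Rightarrow> real"
  assumes "real_distribution D" and \<kappa>: "0 < \<kappa>" "\<kappa> \<le> 1 / 2" and v: "0 < v" and a: "0 < a"
    and large: "4 \<le> \<kappa>\<^sup>2 * (a\<^sup>2 / (2 * v))"
    and mgf: "\<And>s. 0 \<le> s \<Longrightarrow> s \<le> 3 * a / v \<Longrightarrow> (\<integral>\<^sup>+x. ennreal (exp (s * x)) \<partial>D) = ennreal (exp (K s))"
    and K: "\<And>s. 0 \<le> s \<Longrightarrow> s \<le> 3 * a / v \<Longrightarrow> \<bar>K s - v * s\<^sup>2 / 2\<bar> \<le> \<kappa>\<^sup>2 / 10 * (v * s\<^sup>2 / 2)"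
  shows "exp (- ((1 + 3 * \<kappa>) / (1 - \<kappa>)\<^sup>2 * (a\<^sup>2 / (2 * v)))) \<le> measure D {a..}"
proof -
  interpret D: real_distribution D by fact
  \<comment> \<open>The tilt \<open>s\<close> moves the mean of a centred Gaussian law of variance
    \<open>v\<close> to \<open>s * v\<close>, the centre of the window from
    \<open>a = s * v * (1 - \<kappa>)\<close> to \<open>b = s * v * (1 + \<kappa>)\<close>;
    \<open>G\<close> is the Gaussian log-moment at \<open>s\<close>.\<close>
  define s where "s = a / (v * (1 - \<kappa>))"
  define h where "h = \<kappa> * s"
  define b where "b = s * v * (1 + \<kappa>)"
  define G where "G = v * s\<^sup>2 / 2"
  have a_eq: "a = s * v * (1 - \<kappa>)" using \<kappa> v by (simp add: s_def)
  have s: "s > 0" using \<kappa> v a by (simp add: s_def)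
  have G: "G = a\<^sup>2 / (2 * v) / (1 - \<kappa>)\<^sup>2"
  proof -
    have "a\<^sup>2 / (2 * v) / (1 - \<kappa>)\<^sup>2 = (a / (1 - \<kappa>))\<^sup>2 / (2 * v)"
      by (simp add: power_divide)
    also have "a / (1 - \<kappa>) = s * v" using \<kappa> v by (simp add: s_def)
    finally show ?thesis using v by (simp add: G_def power2_eq_square)
  qed
  \<comment> \<open>All exponents must stay in the range where \<open>K\<close> is controlled;
    \<open>1 + \<kappa> \<le> 3 * (1 - \<kappa>)\<close> is exactly
    \<open>\<kappa> \<le> 1 / 2\<close>, hence the 3 in \<open>3 * a / v\<close>.\<close>
  have s3: "s * (1 + \<kappa>) \<le> 3 * a / v"
  proof -
    have "s * (1 + \<kappa>) \<le> s * (3 * (1 - \<kappa>))"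
      using \<kappa> s by (intro mult_left_mono) auto
    also have "\<dots> = 3 * a / v" using v by (simp add: a_eq)
    finally show ?thesis .
  qed
  have G0: "G > 0" using s v by (simp add: G_def)
  have G4: "4 \<le> \<kappa>\<^sup>2 * G"
  proof -
    have "(1 - \<kappa>)\<^sup>2 \<le> 1" using \<kappa> by (simp add: power_le_one)
    then have "a\<^sup>2 / (2 * v) \<le> G"
      unfolding G using \<kappa> v a by (simp add: pos_le_divide_eq mult_left_le)
    then show ?thesis
      using large \<kappa> by (smt (verit) mult_left_mono zero_le_power2)
  qed
  have rng: "0 \<le> r \<and> r \<le> 3 * a / v" if "0 \<le> r" "r \<le> s + h" for r
    using that s3 by (simp add: h_def algebra_simps)
  have hs: "0 < h" "h < s" using \<kappa> s by (auto simp: h_def)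
  have int: "integrable D (\<lambda>x. exp (r * x))" "(\<integral>x. exp (r * x) \<partial>D) = exp (K r)"
    if "0 \<le> r" "r \<le> s + h" for r
  proof -
    have *: "(\<integral>\<^sup>+x. ennreal (exp (r * x)) \<partial>D) = ennreal (exp (K r))"
      using mgf rng[OF that] by blast
    show "integrable D (\<lambda>x. exp (r * x))"
      by (rule integrableI_nn_integral_finite[OF _ _ *]) auto
    show "(\<integral>x. exp (r * x) \<partial>D) = exp (K r)"
      by (subst integral_eq_nn_integral) (auto simp: *)
  qed
  have Ks: "\<bar>K s - G\<bar> \<le> \<kappa>\<^sup>2 / 10 * G"
    unfolding G_def using rng[of s] hs by (intro K) auto
  have Kl: "K (s - h) \<le> (1 + \<kappa>\<^sup>2 / 10) * ((1 - \<kappa>)\<^sup>2 * G)"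
  proof -
    have "s - h = (1 - \<kappa>) * s" by (simp add: h_def algebra_simps)
    then have "v * (s - h)\<^sup>2 / 2 = (1 - \<kappa>)\<^sup>2 * G"
      by (simp add: G_def power_mult_distrib)
    then have "\<bar>K (s - h) - (1 - \<kappa>)\<^sup>2 * G\<bar> \<le> \<kappa>\<^sup>2 / 10 * ((1 - \<kappa>)\<^sup>2 * G)"
      using K[of "s - h"] rng[of "s - h"] hs by auto
    then show ?thesis by (simp only: distrib_right mult_1_left)
  qed
  have Kr: "K (s + h) \<le> (1 + \<kappa>\<^sup>2 / 10) * ((1 + \<kappa>)\<^sup>2 * G)"
  proof -
    have "s + h = (1 + \<kappa>) * s" by (simp add: h_def algebra_simps)
    then have "v * (s + h)\<^sup>2 / 2 = (1 + \<kappa>)\<^sup>2 * G"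
      by (simp add: G_def power_mult_distrib)
    then have "\<bar>K (s + h) - (1 + \<kappa>)\<^sup>2 * G\<bar> \<le> \<kappa>\<^sup>2 / 10 * ((1 + \<kappa>)\<^sup>2 * G)"
      using K[of "s + h"] rng[of "s + h"] hs by auto
    then show ?thesis by (simp only: distrib_right mult_1_left)
  qed
  have ha: "h * a = 2 * G * (\<kappa> * (1 - \<kappa>))" "h * b = 2 * G * (\<kappa> * (1 + \<kappa>))" "s * b = 2 * G * (1 + \<kappa>)"
    by (auto simp: h_def G_def b_def a_eq power2_eq_square algebra_simps)
  have \<kappa>2: "\<kappa>\<^sup>2 \<le> 1 / 4" using power_mono[OF \<kappa>(2), of 2] \<kappa>(1) by (simp add: power2_eq_square)
  \<comment> \<open>At the shifted exponent the quadratic term loses \<open>\<kappa>^2 * G\<close>,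
    which is at least 4; the errors of \<open>K\<close> at \<open>s\<close> and \<open>s - h\<close>
    together cost at most a fifth of it, so more than 2 remains.\<close>
  have left: "h * a + K (s - h) \<le> K s - 2"
  proof -
    have "h * a + K (s - h) \<le> G * ((1 - \<kappa>\<^sup>2) + \<kappa>\<^sup>2 / 10 * (1 - \<kappa>)\<^sup>2)"
      using Kl ha by (simp add: algebra_simps power2_eq_square)
    also have "\<dots> \<le> G * ((1 - \<kappa>\<^sup>2) + \<kappa>\<^sup>2 / 10 * 1)"
      using \<kappa> G0 by (intro mult_left_mono add_left_mono) (auto simp: power_le_one)
    also have "\<dots> = G - \<kappa>\<^sup>2 * G + 1 * (\<kappa>\<^sup>2 * G) / 10"
      by (simp add: algebra_simps)
    also have "\<dots> \<le> K s - 2"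
      using Ks G4 unfolding abs_le_iff by linarith
    finally show ?thesis .
  qed
  \<comment> \<open>The larger exponent is the tight side: with \<open>(1 + \<kappa>)^2\<close>
    bounded by 4 the errors use up half of \<open>\<kappa>^2 * G\<close>, and the other half is at
    least 2. With 1/10 and 4 in the hypotheses the estimate just closes.\<close>
  have right: "K (s + h) - h * b \<le> K s - 2"
  proof -
    have "K (s + h) - h * b \<le> G * ((1 - \<kappa>\<^sup>2) + \<kappa>\<^sup>2 / 10 * (1 + \<kappa>)\<^sup>2)"
    proof -
      have "(1 + \<kappa>\<^sup>2 / 10) * ((1 + \<kappa>)\<^sup>2 * G) - 2 * G * (\<kappa> * (1 + \<kappa>))
          = G * ((1 - \<kappa>\<^sup>2) + \<kappa>\<^sup>2 / 10 * (1 + \<kappa>)\<^sup>2)"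
        by (simp add: field_simps power2_eq_square)
      then show ?thesis using Kr ha(2) by linarith
    qed
    also have "\<dots> \<le> G * ((1 - \<kappa>\<^sup>2) + \<kappa>\<^sup>2 / 10 * (1 + 1)\<^sup>2)"
      using \<kappa> G0 by (intro mult_left_mono add_left_mono power_mono) auto
    also have "\<dots> = G - \<kappa>\<^sup>2 * G + 4 * (\<kappa>\<^sup>2 * G) / 10"
      by (simp add: algebra_simps)
    also have "\<dots> \<le> K s - 2"
      using Ks G4 unfolding abs_le_iff by linarith
    finally show ?thesis .
  qed
  \<comment> \<open>Integrating this pointwise minorant does the work of the tilted law: left of
    \<open>a\<close> and right of \<open>b\<close> one of the subtracted terms dominates
    \<open>exp (s * x)\<close>, and in between the factor \<open>exp (- (s * b))\<close> keeps the
    value at most 1.\<close>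
  have pw: "exp (- (s * b)) * (exp (s * x) - exp (h * a) * exp ((s - h) * x) - exp (- (h * b)) * exp ((s + h) * x))
      \<le> indicator {a..} x" for x
  proof -
    consider "x < a" | "b < x" | "a \<le> x" "x \<le> b" by linarith
    then show ?thesis
    proof cases
      case 1
      have "exp (s * x) \<le> exp (h * a) * exp ((s - h) * x)"
        using 1 hs by (simp add: exp_add[symmetric] algebra_simps)
      then have "exp (s * x) - exp (h * a) * exp ((s - h) * x) - exp (- (h * b)) * exp ((s + h) * x) \<le> 0"
        by (smt (verit) exp_gt_zero mult_pos_pos)
      then show ?thesis
        by (meson exp_ge_zero indicator_pos_le mult_nonneg_nonpos order_trans)
    next
      case 2
      have "exp (s * x) \<le> exp (- (h * b)) * exp ((s + h) * x)"
        using 2 hs by (simp add: exp_add[symmetric] algebra_simps)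
      then have "exp (s * x) - exp (h * a) * exp ((s - h) * x) - exp (- (h * b)) * exp ((s + h) * x) \<le> 0"
        by (smt (verit) exp_gt_zero mult_pos_pos)
      then show ?thesis
        by (meson exp_ge_zero indicator_pos_le mult_nonneg_nonpos order_trans)
    next
      case 3
      have "exp (- (s * b)) * (exp (s * x) - exp (h * a) * exp ((s - h) * x) - exp (- (h * b)) * exp ((s + h) * x))
          \<le> exp (- (s * b)) * exp (s * x)"
      proof (rule mult_left_mono)
        have "0 < exp (h * a) * exp ((s - h) * x)" "0 < exp (- (h * b)) * exp ((s + h) * x)"
          by (simp_all only: exp_gt_zero mult_pos_pos)
        then show "exp (s * x) - exp (h * a) * exp ((s - h) * x) - exp (- (h * b)) * exp ((s + h) * x) \<le> exp (s * x)"
          by linarith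
      qed simp
      also have "\<dots> \<le> 1" using 3 s by (simp add: exp_add[symmetric])
      finally show ?thesis using 3 by simp
    qed
  qed
  have "exp (- (s * b)) * (exp (K s) - exp (h * a) * exp (K (s - h)) - exp (- (h * b)) * exp (K (s + h)))
      = (\<integral>x. exp (- (s * b)) * (exp (s * x) - exp (h * a) * exp ((s - h) * x)
          - exp (- (h * b)) * exp ((s + h) * x)) \<partial>D)"
    using hs by (simp add: int)
  also have "\<dots> \<le> (\<integral>x. indicator {a..} x \<partial>D)"
    by (rule integral_mono[OF _ _ pw]) (use hs in \<open>auto simp: int D.emeasure_eq_measure\<close>)
  finally have P: "exp (- (s * b)) * (exp (K s) - exp (h * a) * exp (K (s - h)) - exp (- (h * b)) * exp (K (s + h)))
      \<le> measure D {a..}" by simp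
  have e2: "exp (- 2) \<le> (1::real) / 4"
  proof -
    have "2 \<le> exp (1::real)" using exp_ge_add_one_self[of 1] by simp
    then have "2 * 2 \<le> exp (1::real) * exp 1" by (intro mult_mono) auto
    then have "4 \<le> exp (2::real)" by (simp add: exp_add[symmetric])
    then show ?thesis by (simp add: exp_minus field_simps)
  qed
  have c1: "exp (h * a) * exp (K (s - h)) \<le> exp (K s) * exp (- 2)"
    unfolding exp_add[symmetric] using left by simp
  have c2: "exp (- (h * b)) * exp (K (s + h)) \<le> exp (K s) * exp (- 2)"
    unfolding exp_add[symmetric] using right by simp
  have "exp (K s) * exp (- 2) \<le> exp (K s) * (1 / 4)"
    using e2 by (intro mult_left_mono) auto
  with c1 c2 have half: "exp (K s) / 2 \<le> exp (K s) - exp (h * a) * exp (K (s - h)) - exp (- (h * b)) * exp (K (s + h))"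
    by linarith
  have "exp (- (1::real)) \<le> 1 / 2"
    using exp_ge_add_one_self[of "1::real"] by (simp add: exp_minus field_simps)
  then have "exp (K s) * exp (- 1) \<le> exp (K s) * (1 / 2)"
    by (rule mult_left_mono) simp
  with half have "exp (K s) * exp (- 1) \<le> exp (K s) - exp (h * a) * exp (K (s - h)) - exp (- (h * b)) * exp (K (s + h))"
    by linarith
  then have "exp (- (s * b)) * (exp (K s) * exp (- 1)) \<le> measure D {a..}"
    by (rule order_trans[OF mult_left_mono P]) simp
  moreover have "exp (- (s * b)) * (exp (K s) * exp (- 1)) = exp (K s - s * b - 1)"
    unfolding exp_add[symmetric] by (rule arg_cong[where f=exp]) simp
  ultimately have E: "exp (K s - s * b - 1) \<le> measure D {a..}" by simp
  \<comment> \<open>Here \<open>s * b = 2 * G * (1 + \<kappa>)\<close>, so the exponent is about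
    \<open>- G - 2 * \<kappa> * G\<close>; a third \<open>\<kappa> * G\<close> absorbs the error of
    \<open>K\<close> and the term 1, and \<open>(1 - \<kappa>)^2\<close> comes from writing
    \<open>G\<close> in terms of \<open>a\<close>.\<close>
  have "- ((1 + 3 * \<kappa>) / (1 - \<kappa>)\<^sup>2 * (a\<^sup>2 / (2 * v))) \<le> K s - s * b - 1"
  proof -
    have "2 * (\<kappa>\<^sup>2 * G) \<le> \<kappa> * G"
      using \<kappa> G0 mult_right_mono[of "2 * \<kappa>" 1 "\<kappa> * G"] by (simp add: power2_eq_square mult_ac)
    moreover have "G - \<kappa>\<^sup>2 * G / 10 \<le> K s" using abs_le_D2[OF Ks] by simp
    ultimately have "- (G + 3 * (\<kappa> * G)) \<le> K s - 2 * (G + \<kappa> * G) - 1"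
      using G4 by argo
    also have "2 * (G + \<kappa> * G) = s * b" using ha(3) by (simp add: algebra_simps)
    finally have "- ((1 + 3 * \<kappa>) * G) \<le> K s - s * b - 1"
      by (simp add: algebra_simps)
    then show ?thesis by (simp add: G mult_ac)
  qed
  then show ?thesis using E by (intro order_trans[OF _ E]) (simp only: exp_le_cancel_iff)
qed

section \<open>Tails of compound Poisson laws and of their limits\<close>

lemma exp_taylor2_bound:
  fixes w :: real
  assumes "\<bar>w\<bar> \<le> 1"
  shows "\<bar>exp w - 1 - w - w\<^sup>2 / 2\<bar> \<le> 2 * \<bar>w\<bar> ^ 3"
proof -
  have "\<bar>exp w - (1 + w + w\<^sup>2 / 2)\<bar> \<le> exp \<bar>w\<bar> * \<bar>w\<bar> ^ 3 / 2"
    using Taylor_exp_field[of w 2] by (simp add: numeral_2_eq_2 numeral_3_eq_3)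
  moreover have "exp \<bar>w\<bar> \<le> 3"
    using exp_le assms by (smt (verit) exp_le_cancel_iff)
  then have "exp \<bar>w\<bar> * \<bar>w\<bar> ^ 3 \<le> 4 * \<bar>w\<bar> ^ 3"
    by (intro mult_right_mono) auto
  ultimately show ?thesis by (simp add: algebra_simps)
qed

text \<open>Jumps of size at most \<open>R\<close> make the centred cumulant function Gaussian up to
  a cubic Taylor term, hence up to a relative error of order \<open>s * R\<close>. The hypothesis on
  \<open>R * (3 * a / v)\<close> keeps this within the tolerance over the whole range of tilts, and
  the sign \<open>\<sigma>\<close> selects the tail.\<close>

lemma compound_poisson_tail:
  fixes N D :: "real measure" and R a v \<kappa> \<sigma> :: real
  assumes "finite_measure N" and sets_N[measurable_cong]: "sets N = sets borel"
    and bounded: "AE x in N. \<bar>x\<bar> \<le> R"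
    and "real_distribution D"
    and mgf: "\<And>s. integrable N (\<lambda>x. exp (s * x)) \<Longrightarrow>
      (\<integral>\<^sup>+x. ennreal (exp (s * x)) \<partial>D) = ennreal (exp (\<integral>x. (exp (s * x) - 1) \<partial>N))"
    and v: "v = (\<integral>x. x\<^sup>2 \<partial>N)" "0 < v" and \<sigma>: "\<bar>\<sigma>\<bar> = 1" and R: "0 < R"
    and \<kappa>: "0 < \<kappa>" "\<kappa> \<le> 1 / 2" and a: "0 < a"
    and large: "4 \<le> \<kappa>\<^sup>2 * (a\<^sup>2 / (2 * v))" and small: "R * (3 * a / v) \<le> \<kappa>\<^sup>2 / 40"
  shows "exp (- ((1 + 3 * \<kappa>) / (1 - \<kappa>)\<^sup>2 * (a\<^sup>2 / (2 * v))))
    \<le> measure D {x. a \<le> \<sigma> * (x - (\<integral>x. x \<partial>N))}"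
proof -
  interpret N: finite_measure N by fact
  interpret D: real_distribution D by fact
  define m where "m = (\<integral>x. x \<partial>N)"
  define D' where "D' = distr D borel (\<lambda>x. \<sigma> * (x - m))"
  define K where "K s = (\<integral>x. (exp (s * \<sigma> * x) - 1 - s * \<sigma> * x) \<partial>N)" for s
  have D': "real_distribution D'"
    unfolding D'_def using D.prob_space_distr[of "\<lambda>x. \<sigma> * (x - m)" borel]
    by (simp add: real_distribution_def real_distribution_axioms_def)
  have sq: "\<sigma> * \<sigma> = 1" using \<sigma> by (simp add: abs_if split: if_splits)
  have int_exp: "integrable N (\<lambda>x. exp (s * x))" for s
  proof (rule N.integrable_const_bound[where B="exp (\<bar>s\<bar> * R)"])
    show "AE x in N. norm (exp (s * x)) \<le> exp (\<bar>s\<bar> * R)"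
      using bounded
    proof eventually_elim
      case (elim x)
      have "s * x \<le> \<bar>s\<bar> * \<bar>x\<bar>" by (metis abs_ge_self abs_mult)
      also have "\<dots> \<le> \<bar>s\<bar> * R" using elim by (intro mult_left_mono) auto
      finally show ?case by simp
    qed
  qed simp
  have int_x: "integrable N (\<lambda>x. x)"
    by (rule N.integrable_const_bound[where B=R]) (simp_all add: bounded)
  have int_x2: "integrable N (\<lambda>x. x\<^sup>2)"
  proof (rule N.integrable_const_bound[where B="R\<^sup>2"])
    show "AE x in N. norm (x\<^sup>2) \<le> R\<^sup>2"
      using bounded
    proof eventually_elim
      case (elim x)
      then have "\<bar>x\<bar>\<^sup>2 \<le> R\<^sup>2" by (rule power_mono) simp
      then show ?case by simp
    qed
  qed simp
  have "exp (- ((1 + 3 * \<kappa>) / (1 - \<kappa>)\<^sup>2 * (a\<^sup>2 / (2 * v)))) \<le> measure D' {a..}"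
  proof (rule mgf_tail_lower_bound[where K=K])
    fix s assume s: "0 \<le> s" "s \<le> 3 * a / v"
    have "(\<integral>\<^sup>+x. ennreal (exp (s * x)) \<partial>D') = (\<integral>\<^sup>+x. ennreal (exp (- (s * \<sigma> * m))) * ennreal (exp (s * \<sigma> * x)) \<partial>D)"
    proof -
      have *: "exp (s * (\<sigma> * (x - m))) = exp (- (s * \<sigma> * m)) * exp (s * \<sigma> * x)" for x
        unfolding mult_exp_exp by (rule arg_cong[where f=exp]) (simp add: algebra_simps)
      have "(\<integral>\<^sup>+x. ennreal (exp (s * x)) \<partial>D') = (\<integral>\<^sup>+x. ennreal (exp (s * (\<sigma> * (x - m)))) \<partial>D)"
        unfolding D'_def by (subst nn_integral_distr) auto
      then show ?thesis
        unfolding * by (subst (asm) ennreal_mult) auto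
    qed
    also have "\<dots> = ennreal (exp (- (s * \<sigma> * m))) * ennreal (exp (\<integral>x. (exp (s * \<sigma> * x) - 1) \<partial>N))"
      unfolding mgf[OF int_exp, symmetric] by (rule nn_integral_cmult) simp
    also have "\<dots> = ennreal (exp ((\<integral>x. (exp (s * \<sigma> * x) - 1) \<partial>N) - s * \<sigma> * m))"
      by (subst ennreal_mult[symmetric]) (auto simp: mult_exp_exp)
    also have "(\<integral>x. (exp (s * \<sigma> * x) - 1) \<partial>N) - s * \<sigma> * m = K s"
      unfolding K_def m_def using int_exp int_x by simp
    finally show "(\<integral>\<^sup>+x. ennreal (exp (s * x)) \<partial>D') = ennreal (exp (K s))" .
    have sR: "s * R \<le> \<kappa>\<^sup>2 / 40"
    proof -
      have "R * s \<le> R * (3 * a / v)" using s(2) R by (intro mult_left_mono) auto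
      then show ?thesis using small by (simp only: mult.commute[of s R])
    qed
    have "\<kappa>\<^sup>2 \<le> 1" using \<kappa> by (simp add: power_le_one)
    have K_eq: "K s - v * s\<^sup>2 / 2 = (\<integral>x. (exp (s * \<sigma> * x) - 1 - s * \<sigma> * x) - (s * \<sigma> * x)\<^sup>2 / 2 \<partial>N)"
    proof -
      have "(s * \<sigma> * x)\<^sup>2 / 2 = s\<^sup>2 / 2 * x\<^sup>2" for x
        using sq by (simp add: power_mult_distrib power2_eq_square[of \<sigma>])
      then show ?thesis
        unfolding K_def v(1) using int_exp[of "s * \<sigma>"] int_x int_x2 by simp
    qed
    have "\<bar>K s - v * s\<^sup>2 / 2\<bar> \<le> (\<integral>x. \<bar>(exp (s * \<sigma> * x) - 1 - s * \<sigma> * x) - (s * \<sigma> * x)\<^sup>2 / 2\<bar> \<partial>N)"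
      unfolding K_eq by (rule integral_abs_bound)
    also have "\<dots> \<le> (\<integral>x. \<kappa>\<^sup>2 / 20 * s\<^sup>2 * x\<^sup>2 \<partial>N)"
    proof (rule integral_mono_AE)
      show "AE x in N. \<bar>(exp (s * \<sigma> * x) - 1 - s * \<sigma> * x) - (s * \<sigma> * x)\<^sup>2 / 2\<bar> \<le> \<kappa>\<^sup>2 / 20 * s\<^sup>2 * x\<^sup>2"
        using bounded
      proof eventually_elim
        case (elim x)
        have abs: "\<bar>s * \<sigma> * x\<bar> = s * \<bar>x\<bar>" unfolding abs_mult \<sigma> using s(1) by simp
        have w: "s * \<bar>x\<bar> \<le> \<kappa>\<^sup>2 / 40"
          by (rule order_trans[OF mult_left_mono[OF elim s(1)] sR])
        then have "\<bar>s * \<sigma> * x\<bar> \<le> 1" using \<open>\<kappa>\<^sup>2 \<le> 1\<close> unfolding abs by linarith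
        from exp_taylor2_bound[OF this]
        have "\<bar>(exp (s * \<sigma> * x) - 1 - s * \<sigma> * x) - (s * \<sigma> * x)\<^sup>2 / 2\<bar> \<le> 2 * (s * \<bar>x\<bar>) ^ 3"
          unfolding abs .
        also have "\<dots> = 2 * ((s * \<bar>x\<bar>) * (s * \<bar>x\<bar>)\<^sup>2)" by (simp add: power2_eq_square power3_eq_cube)
        \<comment> \<open>One of the three factors is traded for \<open>\<kappa>^2 / 40\<close>;
          since the variance enters the cumulant function with 1/2, the relative error becomes
          \<open>\<kappa>^2 / 10\<close>.\<close>
        also have "\<dots> \<le> 2 * (\<kappa>\<^sup>2 / 40 * (s * \<bar>x\<bar>)\<^sup>2)"
          using w by (intro mult_left_mono mult_right_mono) auto
        also have "\<dots> = \<kappa>\<^sup>2 / 20 * s\<^sup>2 * x\<^sup>2" by (simp add: power_mult_distrib)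
        finally show ?case .
      qed
      show "integrable N (\<lambda>x. \<bar>(exp (s * \<sigma> * x) - 1 - s * \<sigma> * x) - (s * \<sigma> * x)\<^sup>2 / 2\<bar>)"
        unfolding power_mult_distrib
        by (intro integrable_abs Bochner_Integration.integrable_diff integrable_divide_zero
            integrable_mult_right int_exp int_x int_x2 N.integrable_const)
      show "integrable N (\<lambda>x. \<kappa>\<^sup>2 / 20 * s\<^sup>2 * x\<^sup>2)"
        by (intro integrable_mult_right int_x2)
    qed
    also have "\<dots> = \<kappa>\<^sup>2 / 10 * (v * s\<^sup>2 / 2)"
      using int_x2 by (simp add: v(1))
    finally show "\<bar>K s - v * s\<^sup>2 / 2\<bar> \<le> \<kappa>\<^sup>2 / 10 * (v * s\<^sup>2 / 2)" .
  qed (rule D' \<kappa> v(2) a large)+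
  also have "measure D' {a..} = measure D {x. a \<le> \<sigma> * (x - m)}"
    unfolding D'_def by (subst measure_distr) (auto simp: vimage_def)
  finally show ?thesis unfolding m_def .
qed

text \<open>For each value \<open>x\<close> of the independent summand, one of the two tails is enough, depending on the
  sign of \<open>x + m\<close>.\<close>

lemma two_sided_tail_convolution:
  fixes D E :: "real measure" and a m p :: real
  assumes "real_distribution D" "real_distribution E"
    and upper: "p \<le> measure D {x. a \<le> x - m}" and lower: "p \<le> measure D {x. a \<le> m - x}"
  shows "p \<le> measure (E \<star> D) {x. a \<le> \<bar>x\<bar>}"
proof (cases "0 \<le> p")
  case True
  interpret D: real_distribution D by fact
  interpret E: real_distribution E by fact
  interpret ED: real_distribution "E \<star> D" by (rule real_distribution_convolution) fact+
  have mono: "ennreal p \<le> emeasure D {y. y + x \<in> {x. a \<le> \<bar>x\<bar>}}" for x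
  proof (cases "0 \<le> x + m")
    case True
    have "p \<le> measure D {y. y + x \<in> {x. a \<le> \<bar>x\<bar>}}"
      by (rule order_trans[OF upper], rule D.finite_measure_mono) (use True in auto)
    then show ?thesis by (simp add: D.emeasure_eq_measure)
  next
    case False
    have "p \<le> measure D {y. y + x \<in> {x. a \<le> \<bar>x\<bar>}}"
      by (rule order_trans[OF lower], rule D.finite_measure_mono) (use False in auto)
    then show ?thesis by (simp add: D.emeasure_eq_measure)
  qed
  have "ennreal p = (\<integral>\<^sup>+x. ennreal p \<partial>E)" using E.emeasure_space_1 by simp
  also have "\<dots> \<le> (\<integral>\<^sup>+x. emeasure D {y. y + x \<in> {x. a \<le> \<bar>x\<bar>}} \<partial>E)"
    by (rule nn_integral_mono) (rule mono)
  also have "\<dots> = emeasure (E \<star> D) {x. a \<le> \<bar>x\<bar>}"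
    by (rule convolution_emeasure[symmetric]) (auto simp: D.finite_measure_axioms E.finite_measure_axioms)
  finally show ?thesis by (simp add: ED.emeasure_eq_measure)
qed (use measure_nonneg in \<open>auto intro: order_trans[of _ 0]\<close>)

text \<open>Portmanteau for a closed set: a continuous ramp between the levels \<open>a'\<close> and
  \<open>a\<close> carries the bound to the limit law for every \<open>a' < a\<close>, and
  continuity of \<open>D\<close> along decreasing sets restores \<open>a\<close>.\<close>

lemma weak_conv_tail_lower_bound:
  fixes W :: "nat \<Rightarrow> real measure" and D :: "real measure" and a p :: real
  assumes W: "\<And>n. real_distribution (W n)" and D: "real_distribution D"
    and conv: "weak_conv_m W D"
    and tail: "\<And>n. p \<le> measure (W n) {x. a \<le> \<bar>x\<bar>}"
  shows "p \<le> measure D {x. a \<le> \<bar>x\<bar>}"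
proof -
  interpret D: real_distribution D by fact
  have *: "p \<le> measure D {x. a' \<le> \<bar>x\<bar>}" if "a' < a" for a'
  proof -
    define f where "f x = min 1 (max 0 ((\<bar>x\<bar> - a') / (a - a')))" for x
    have cont: "isCont f x" for x
      unfolding f_def using that by (intro continuous_intros) auto
    have [measurable]: "f \<in> borel_measurable borel"
      by (intro borel_measurable_continuous_onI continuous_at_imp_continuous_on ballI cont)
    have f01: "0 \<le> f x" "f x \<le> 1" for x by (auto simp: f_def)
    have f1: "indicator {x. a \<le> \<bar>x\<bar>} x \<le> f x" for x
      using that by (auto simp: f_def indicator_def field_simps)
    have f2: "f x \<le> indicator {x. a' \<le> \<bar>x\<bar>} x" for x
      using that by (auto simp: f_def indicator_def field_simps)
    have "(\<lambda>n. integral\<^sup>L (W n) f) \<longlonglongrightarrow> integral\<^sup>L D f"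
      using f01 by (intro weak_conv_imp_integral_bdd_continuous_conv[where B=1] W D conv cont) auto
    moreover have "p \<le> integral\<^sup>L (W n) f" for n
    proof -
      interpret W: real_distribution "W n" by (rule W)
      have "measure (W n) {x. a \<le> \<bar>x\<bar>} = (\<integral>x. indicator {x. a \<le> \<bar>x\<bar>} x \<partial>W n)" by simp
      also have "\<dots> \<le> integral\<^sup>L (W n) f"
        using f01 by (intro integral_mono f1 W.integrable_const_bound[where B=1]) auto
      finally show ?thesis using tail[of n] by simp
    qed
    ultimately have "p \<le> integral\<^sup>L D f"
      by (intro LIMSEQ_le_const) auto
    also have "\<dots> \<le> (\<integral>x. indicator {x. a' \<le> \<bar>x\<bar>} x \<partial>D)"
      using f01 by (intro integral_mono f2 D.integrable_const_bound[where B=1]) auto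
    finally show ?thesis by simp
  qed
  have "(\<lambda>k. measure D {x. a - 1 / real (Suc k) \<le> \<bar>x\<bar>}) \<longlonglongrightarrow> measure D (\<Inter>k. {x. a - 1 / real (Suc k) \<le> \<bar>x\<bar>})"
  proof (rule D.finite_Lim_measure_decseq)
    have "1 / real (Suc n) \<le> 1 / real (Suc k)" if "k \<le> n" for k n
      using that by (simp add: frac_le)
    then show "decseq (\<lambda>k. {x. a - 1 / real (Suc k) \<le> \<bar>x\<bar>})"
      by (fastforce simp: decseq_def intro: order_trans[rotated])
  qed auto
  then have "p \<le> measure D (\<Inter>k. {x. a - 1 / real (Suc k) \<le> \<bar>x\<bar>})"
    by (rule LIMSEQ_le_const) (auto intro!: *)
  also have "(\<Inter>k. {x. a - 1 / real (Suc k) \<le> \<bar>x\<bar>}) = {x. a \<le> \<bar>x\<bar>}"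
  proof (intro equalityI subsetI)
    fix x assume x: "x \<in> (\<Inter>k. {x. a - 1 / real (Suc k) \<le> \<bar>x\<bar>})"
    have "(\<lambda>k. a - 1 / real (Suc k)) \<longlonglongrightarrow> a - 0"
      by (intro tendsto_intros LIMSEQ_Suc[OF lim_1_over_n])
    then have "a - 0 \<le> \<bar>x\<bar>"
      by (rule LIMSEQ_le_const2) (use x in auto)
    then show "x \<in> {x. a \<le> \<bar>x\<bar>}" by simp
  qed (auto intro: order_trans[rotated])
  finally show ?thesis .
qed

section \<open>One-dimensional projections of Levy laws\<close>

text \<open>A weight \<open>g\<close> rather than a set of jumps: an integrable \<open>g\<close>
  cuts out the possibly infinite mass near the origin, and a weight below the full rate lets jumps
  of the same size be shared between two laws.\<close>

definition proj_measure :: "(real^'n) measure \<Rightarrow> real^'n \<Rightarrow> (real^'n \<Rightarrow> real) \<Rightarrow> real measure" where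
  "proj_measure L z g = distr (density L (\<lambda>y. ennreal (g y))) borel (\<lambda>y. y \<bullet> z)"

lemma sets_proj_measure: "sets (proj_measure L z g) = sets borel"
  by (simp add: proj_measure_def)

lemma finite_measure_proj_measure:
  assumes [measurable_cong]: "sets L = sets borel" and "integrable L g" "\<And>y. 0 \<le> g y"
  shows "finite_measure (proj_measure L z g)"
proof -
  have [measurable]: "g \<in> borel_measurable L" using assms by auto
  have "finite_measure (density L (\<lambda>y. ennreal (g y)))"
  proof (rule finite_measureI)
    have "emeasure (density L (\<lambda>y. ennreal (g y))) (space L) = (\<integral>\<^sup>+y. ennreal (g y) \<partial>L)"
      by (subst emeasure_density) (auto intro!: nn_integral_cong)
    also have "\<dots> = ennreal (\<integral>y. g y \<partial>L)"
      using assms by (intro nn_integral_eq_integral) auto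
    finally show "emeasure (density L (\<lambda>y. ennreal (g y))) (space (density L (\<lambda>y. ennreal (g y)))) \<noteq> \<infinity>"
      by simp
  qed
  then show ?thesis
    unfolding proj_measure_def by (rule finite_measure.finite_measure_distr) simp
qed

lemma integral_proj_measure:
  fixes f :: "real \<Rightarrow> 'b::{banach, second_countable_topology}"
  assumes [measurable_cong]: "sets L = sets borel" and "g \<in> borel_measurable L" "\<And>y. 0 \<le> g y"
    and [measurable]: "f \<in> borel_measurable borel"
  shows "(\<integral>x. f x \<partial>proj_measure L z g) = (\<integral>y. g y *\<^sub>R f (y \<bullet> z) \<partial>L)"
  unfolding proj_measure_def using assms(2,3)
  by (subst integral_distr) (auto intro!: integral_density)

lemma AE_proj_measure_bounded:
  assumes [measurable_cong]: "sets L = sets borel" and [measurable]: "g \<in> borel_measurable L"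
    and g: "\<And>y. 0 < g y \<Longrightarrow> norm y \<le> R" and z: "norm z \<le> 1" and R: "0 \<le> R"
  shows "AE x in proj_measure L z g. \<bar>x\<bar> \<le> R"
proof -
  have "\<bar>y \<bullet> z\<bar> \<le> R" if "0 < g y" for y
  proof -
    have "\<bar>y \<bullet> z\<bar> \<le> norm y * norm z" by (rule Cauchy_Schwarz_ineq2)
    also have "\<dots> \<le> R * 1" using g[OF that] z R by (intro mult_mono) auto
    finally show ?thesis by simp
  qed
  then show ?thesis
    unfolding proj_measure_def by (subst AE_distr_iff) (auto simp: AE_density)
qed

lemma levy_measure_integrable:
  fixes L :: "(real^'n) measure" and f :: "real^'n \<Rightarrow> 'b::{banach, second_countable_topology}"
  assumes "levy_measure L" "f \<in> borel_measurable borel"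
    and bound: "\<And>y. norm (f y) \<le> C * min 1 (norm y ^ 2)"
  shows "integrable L f"
proof -
  have [measurable_cong]: "sets L = sets borel"
    and fin: "(\<integral>\<^sup>+ y. ennreal (min 1 (norm y ^ 2)) \<partial>L) < \<infinity>"
    using assms by (auto simp: levy_measure_def)
  note [measurable] = assms(2)
  have "integrable L (\<lambda>y. min 1 (norm y ^ 2))"
    using fin by (intro integrableI_nonneg) auto
  then have "integrable L (\<lambda>y. C * min 1 (norm y ^ 2))"
    by simp
  then show ?thesis
    by (rule Bochner_Integration.integrable_bound) (auto intro!: AE_I2 order_trans[OF bound])
qed

text \<open>Second-order Taylor expansion in the unit ball, where the compensator acts, and the
  trivial bound 2 outside; the constant covers both.\<close>

lemma levy_integrand_bound:
  fixes y z :: "real^'n"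
  assumes "norm z \<le> 1"
  shows "norm (iexp (s * (y \<bullet> z)) - 1 - \<i> * of_real (s * (y \<bullet> z)) * of_real (indicator (cball 0 1) y))
    \<le> (2 + s\<^sup>2) * min 1 (norm y ^ 2)"
proof (cases "norm y \<le> 1")
  case True
  have "\<bar>y \<bullet> z\<bar> \<le> norm y * norm z" by (rule Cauchy_Schwarz_ineq2)
  also have "\<dots> \<le> norm y * 1" using assms by (intro mult_left_mono) auto
  finally have "\<bar>y \<bullet> z\<bar>\<^sup>2 \<le> (norm y)\<^sup>2" by (intro power_mono) auto
  then have sq: "(y \<bullet> z)\<^sup>2 \<le> (norm y)\<^sup>2" by simp
  have "norm (iexp (s * (y \<bullet> z)) - (1 + \<i> * of_real (s * (y \<bullet> z)))) \<le> (s * (y \<bullet> z))\<^sup>2 / 2"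
    using iexp_approx1[of "s * (y \<bullet> z)" 1] by (simp add: numeral_2_eq_2)
  also have "\<dots> \<le> s\<^sup>2 * (norm y)\<^sup>2"
    using mult_left_mono[OF sq, of "s\<^sup>2"] by (simp add: power_mult_distrib) (smt (verit) zero_le_mult_iff zero_le_power2)
  also have "\<dots> \<le> (2 + s\<^sup>2) * (norm y)\<^sup>2" by (intro mult_right_mono) auto
  also have "(norm y)\<^sup>2 = min 1 ((norm y)\<^sup>2)" using True by (simp add: power_le_one)
  finally show ?thesis using True by (simp add: diff_diff_eq)
next
  case False
  have "norm (iexp (s * (y \<bullet> z)) - 1) \<le> norm (iexp (s * (y \<bullet> z))) + norm (1::complex)"
    by (rule norm_triangle_ineq4)
  also have "\<dots> \<le> 2 + s\<^sup>2" by simp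
  also have "1 \<le> (norm y)\<^sup>2" using False by simp
  then have "2 + s\<^sup>2 = (2 + s\<^sup>2) * min 1 ((norm y)\<^sup>2)" by simp
  finally show ?thesis using False by simp
qed

text \<open>Only the fraction \<open>\<rho>\<close> of the jumps in \<open>A\<close> enters the nearly Gaussian part \<open>D\<close>, whose variance is then
  exactly \<open>v\<close> even if the truncated variance is much larger; all other jumps go to \<open>D'\<close>.\<close>

lemma truncated_levy_law:
  fixes L :: "(real^'n) measure" and \<gamma> z :: "real^'n" and u \<epsilon> R v a \<kappa> :: real
  defines "A \<equiv> {y::real^'n. \<epsilon> < norm y \<and> norm y \<le> R}" and "B \<equiv> {y::real^'n. \<epsilon> < norm y}"
  assumes L: "levy_measure L" and z: "norm z \<le> 1" and u: "0 < u" and \<epsilon>: "0 < \<epsilon>" and R: "0 < R"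
    and v: "0 < v" "v \<le> u * (\<integral>y. indicator A y * (y \<bullet> z)\<^sup>2 \<partial>L)"
    and \<kappa>: "0 < \<kappa>" "\<kappa> \<le> 1 / 2" and a: "0 < a"
    and large: "4 \<le> \<kappa>\<^sup>2 * (a\<^sup>2 / (2 * v))" and small: "R * (3 * a / v) \<le> \<kappa>\<^sup>2 / 40"
  obtains W where "real_distribution W"
    and "\<And>t. char W t = exp (of_real u * (\<i> * of_real (t * (\<gamma> \<bullet> z)) + (\<integral>y. indicator B y *\<^sub>R
      (iexp (t * (y \<bullet> z)) - 1 - \<i> * of_real (t * (y \<bullet> z)) * of_real (indicator (cball 0 1) y)) \<partial>L)))"
    and "exp (- ((1 + 3 * \<kappa>) / (1 - \<kappa>)\<^sup>2 * (a\<^sup>2 / (2 * v)))) \<le> measure W {x. a \<le> \<bar>x\<bar>}"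
proof -
  have sets_L[measurable_cong]: "sets L = sets borel" using L by (simp add: levy_measure_def)
  have [measurable]: "A \<in> sets borel" "B \<in> sets borel" unfolding A_def B_def by measurable
  have [measurable]: "cball (0::real^'n) r \<in> sets borel" for r by simp
  \<comment> \<open>Away from the origin the measure is finite, so bounded functions supported in
    \<open>B\<close> are integrable: there \<open>min 1 (\<epsilon>^2)\<close> is a positive lower
    bound for the canonical weight \<open>min 1 (norm y ^ 2)\<close>.\<close>
  have far: "integrable L f" if "f \<in> borel_measurable borel" "\<And>y. norm (f y) \<le> K * indicator B y"
    for f :: "real^'n \<Rightarrow> 'b::{banach, second_countable_topology}" and K
  proof (rule levy_measure_integrable[OF L that(1)])
    fix y :: "real^'n"
    show "norm (f y) \<le> (\<bar>K\<bar> / min 1 (\<epsilon>\<^sup>2)) * min 1 (norm y ^ 2)"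
    proof (cases "y \<in> B")
      case True
      have "\<epsilon>\<^sup>2 \<le> (norm y)\<^sup>2" using True \<epsilon> by (intro power_mono) (auto simp: B_def)
      then have "min 1 (\<epsilon>\<^sup>2) \<le> min 1 (norm y ^ 2)" by (intro min.mono) auto
      moreover have "0 < min 1 (\<epsilon>\<^sup>2)" using \<epsilon> by simp
      ultimately have "1 \<le> min 1 (norm y ^ 2) / min 1 (\<epsilon>\<^sup>2)" by (simp only: le_divide_eq if_True mult_1_left)
      then have "\<bar>K\<bar> * 1 \<le> \<bar>K\<bar> * (min 1 (norm y ^ 2) / min 1 (\<epsilon>\<^sup>2))" by (intro mult_left_mono) auto
      moreover have "norm (f y) \<le> \<bar>K\<bar>" using that(2)[of y] True by simp
      ultimately show ?thesis by simp
    next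
      case False
      then have "norm (f y) \<le> 0" using that(2)[of y] by simp
      moreover have "0 \<le> (\<bar>K\<bar> / min 1 (\<epsilon>\<^sup>2)) * min 1 (norm y ^ 2)" by (intro mult_nonneg_nonneg divide_nonneg_nonneg) auto
      ultimately show ?thesis by linarith
    qed
  qed
  have yz: "\<bar>y \<bullet> z\<bar> \<le> norm y" for y
    using Cauchy_Schwarz_ineq2[of y z] mult_left_mono[OF z, of "norm y"] by simp
  define J where "J = (\<integral>y. indicator A y * (y \<bullet> z)\<^sup>2 \<partial>L)"
  define \<rho> where "\<rho> = v / (u * J)"
  have uJ: "0 < u * J" using v by (simp add: J_def)
  have \<rho>: "0 < \<rho>" "\<rho> \<le> 1" "u * \<rho> * J = v"
    using v uJ by (auto simp: \<rho>_def J_def[symmetric] divide_le_eq)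
  define g where "g y = u * \<rho> * indicator A y" for y :: "real^'n"
  \<comment> \<open>By construction \<open>g + h\<close> is \<open>u\<close> times the indicator of
    \<open>B\<close>, so the two compound Poisson laws recombine to the full truncated law;
    \<open>\<rho> \<le> 1\<close> keeps \<open>h\<close> nonnegative.\<close>
  define h where "h y = u * indicator B y - g y" for y :: "real^'n"
  have [measurable]: "g \<in> borel_measurable borel" "h \<in> borel_measurable borel"
    unfolding g_def h_def by measurable
  have g0: "0 \<le> g y" for y using u \<rho> by (simp add: g_def)
  have gB: "g y \<le> u * indicator B y" for y
    using u \<rho> mult_left_le[of \<rho> u] by (auto simp: g_def A_def B_def indicator_def)
  have h0: "0 \<le> h y" for y using gB[of y] by (simp add: h_def)
  have hB: "h y \<le> u * indicator B y" for y using g0[of y] by (simp add: h_def)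
  have ig: "integrable L g" by (rule far[of _ u]) (use g0 gB in auto)
  have ih: "integrable L h" by (rule far[of _ u]) (use h0 hB in auto)
  let ?N = "proj_measure L z g" and ?N' = "proj_measure L z h"
  have fN: "finite_measure ?N" by (rule finite_measure_proj_measure[OF sets_L ig g0])
  have fN': "finite_measure ?N'" by (rule finite_measure_proj_measure[OF sets_L ih h0])
  obtain D where D: "real_distribution D"
    and charD: "\<And>t. char D t = exp (CLINT x|?N. (iexp (t * x) - 1))"
    and mgfD: "\<And>s. integrable ?N (\<lambda>x. exp (s * x)) \<Longrightarrow>
      (\<integral>\<^sup>+x. ennreal (exp (s * x)) \<partial>D) = ennreal (exp (\<integral>x. (exp (s * x) - 1) \<partial>?N))"
    using compound_poisson_exists[OF fN sets_proj_measure] by metis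
  obtain D' where D': "real_distribution D'"
    and charD': "\<And>t. char D' t = exp (CLINT x|?N'. (iexp (t * x) - 1))"
    using compound_poisson_exists[OF fN' sets_proj_measure] by metis
  have int_sq: "v = (\<integral>x. x\<^sup>2 \<partial>?N)"
  proof -
    have "(\<integral>x. x\<^sup>2 \<partial>?N) = (\<integral>y. g y *\<^sub>R (y \<bullet> z)\<^sup>2 \<partial>L)"
      by (rule integral_proj_measure[OF sets_L _ g0]) auto
    also have "\<dots> = u * \<rho> * J" by (simp add: g_def J_def mult.assoc)
    finally show ?thesis using \<rho> by simp
  qed
  have bdd: "AE x in ?N. \<bar>x\<bar> \<le> R"
  proof (rule AE_proj_measure_bounded[OF sets_L _ _ z])
    show "norm y \<le> R" if "0 < g y" for y
      using that by (cases "y \<in> A") (auto simp: g_def A_def)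
  qed (use R in auto)
  define m where "m = (\<integral>x. x \<partial>?N)"
  let ?p = "exp (- ((1 + 3 * \<kappa>) / (1 - \<kappa>)\<^sup>2 * (a\<^sup>2 / (2 * v))))"
  have upper: "?p \<le> measure D {x. a \<le> x - m}"
    using compound_poisson_tail[OF fN sets_proj_measure bdd D mgfD int_sq v(1) _ R \<kappa> a large small, of 1]
    by (simp add: m_def)
  have lower: "?p \<le> measure D {x. a \<le> m - x}"
    using compound_poisson_tail[OF fN sets_proj_measure bdd D mgfD int_sq v(1) _ R \<kappa> a large small, of "-1"]
    by (simp add: m_def)
  \<comment> \<open>The compound Poisson laws carry no compensator. The compensator \<open>c\<close>
    of the jumps in \<open>B\<close> is finite because these avoid the origin, and the point mass at
    \<open>d\<close> restores drift minus compensator.\<close>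
  define c where "c = (\<integral>y. indicator (B \<inter> cball 0 1) y * (y \<bullet> z) \<partial>L)"
  define d where "d = u * (\<gamma> \<bullet> z) - u * c"
  define E where "E = (return borel d \<star> D')"
  have E: "real_distribution E"
    unfolding E_def by (intro real_distribution_convolution real_distribution_return D')
  show thesis
  proof (rule that)
    show "real_distribution (E \<star> D)" by (intro real_distribution_convolution E D)
    show "?p \<le> measure (E \<star> D) {x. a \<le> \<bar>x\<bar>}"
      by (rule two_sided_tail_convolution[OF D E upper lower])
    fix t
    define \<phi> where "\<phi> y = iexp (t * (y \<bullet> z)) - 1" for y :: "real^'n"
    have \<phi>_meas[measurable]: "\<phi> \<in> borel_measurable borel" unfolding \<phi>_def by measurable
    have \<phi>2: "norm (\<phi> y) \<le> 2" for y
      unfolding \<phi>_def using norm_triangle_ineq4[of "iexp (t * (y \<bullet> z))" 1] by simp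
    have i\<phi>: "integrable L (\<lambda>y. indicator B y *\<^sub>R \<phi> y)"
      by (rule far[of _ 2]) (use \<phi>2 in \<open>auto simp: indicator_def\<close>)
    have ig\<phi>: "integrable L (\<lambda>y. g y *\<^sub>R \<phi> y)"
    proof (rule far[of _ "u * 2"])
      fix y
      have "norm (g y *\<^sub>R \<phi> y) \<le> (u * indicator B y) * 2"
        using g0[of y] gB[of y] \<phi>2[of y] u unfolding norm_scaleR by (intro mult_mono) auto
      then show "norm (g y *\<^sub>R \<phi> y) \<le> u * 2 * indicator B y" by (simp add: mult_ac)
    qed simp
    have ih\<phi>: "integrable L (\<lambda>y. h y *\<^sub>R \<phi> y)"
    proof (rule far[of _ "u * 2"])
      fix y
      have "norm (h y *\<^sub>R \<phi> y) \<le> (u * indicator B y) * 2"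
        using h0[of y] hB[of y] \<phi>2[of y] u unfolding norm_scaleR by (intro mult_mono) auto
      then show "norm (h y *\<^sub>R \<phi> y) \<le> u * 2 * indicator B y" by (simp add: mult_ac)
    qed simp
    have ic: "integrable L (\<lambda>y. indicator (B \<inter> cball 0 1) y * (y \<bullet> z))"
    proof (rule far[of _ 1])
      fix y :: "real^'n"
      show "norm (indicator (B \<inter> cball 0 1) y * (y \<bullet> z)) \<le> 1 * indicator B y"
        using yz[of y] by (auto simp: indicator_def)
    qed measurable
    have N: "(CLINT x|?N. (iexp (t * x) - 1)) = (\<integral>y. g y *\<^sub>R \<phi> y \<partial>L)"
      unfolding \<phi>_def by (rule integral_proj_measure[OF sets_L _ g0]) auto
    have N': "(CLINT x|?N'. (iexp (t * x) - 1)) = (\<integral>y. h y *\<^sub>R \<phi> y \<partial>L)"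
      unfolding \<phi>_def by (rule integral_proj_measure[OF sets_L _ h0]) auto
    have sum: "(\<integral>y. h y *\<^sub>R \<phi> y \<partial>L) + (\<integral>y. g y *\<^sub>R \<phi> y \<partial>L) = of_real u * (\<integral>y. indicator B y *\<^sub>R \<phi> y \<partial>L)"
    proof -
      have "(\<integral>y. h y *\<^sub>R \<phi> y \<partial>L) + (\<integral>y. g y *\<^sub>R \<phi> y \<partial>L) = (\<integral>y. h y *\<^sub>R \<phi> y + g y *\<^sub>R \<phi> y \<partial>L)"
        using ig\<phi> ih\<phi> by simp
      also have "\<dots> = (\<integral>y. of_real u * (indicator B y *\<^sub>R \<phi> y) \<partial>L)"
        by (intro Bochner_Integration.integral_cong refl)
          (simp add: h_def scaleR_conv_of_real algebra_simps)
      also have "\<dots> = of_real u * (\<integral>y. indicator B y *\<^sub>R \<phi> y \<partial>L)"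
        by (rule integral_mult_right_zero)
      finally show ?thesis .
    qed
    have comp: "(\<integral>y. indicator B y *\<^sub>R
        (iexp (t * (y \<bullet> z)) - 1 - \<i> * of_real (t * (y \<bullet> z)) * of_real (indicator (cball 0 1) y)) \<partial>L)
        = (\<integral>y. indicator B y *\<^sub>R \<phi> y \<partial>L) - \<i> * of_real (t * c)"
    proof -
      have "(\<integral>y. indicator B y *\<^sub>R
        (iexp (t * (y \<bullet> z)) - 1 - \<i> * of_real (t * (y \<bullet> z)) * of_real (indicator (cball 0 1) y)) \<partial>L)
        = (\<integral>y. indicator B y *\<^sub>R \<phi> y - \<i> * of_real t * of_real (indicator (B \<inter> cball 0 1) y * (y \<bullet> z)) \<partial>L)"
        by (intro Bochner_Integration.integral_cong refl)
          (auto simp: \<phi>_def indicator_def scaleR_conv_of_real)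
      also have "\<dots> = (\<integral>y. indicator B y *\<^sub>R \<phi> y \<partial>L) - \<i> * of_real t * (\<integral>y. of_real (indicator (B \<inter> cball 0 1) y * (y \<bullet> z)) \<partial>L)"
      proof -
        have "integrable L (\<lambda>y. \<i> * of_real t * complex_of_real (indicator (B \<inter> cball 0 1) y * (y \<bullet> z)))"
          by (intro integrable_mult_right integrable_of_real ic)
        from Bochner_Integration.integral_diff[OF i\<phi> this] show ?thesis by simp
      qed
      also have "(\<integral>y. complex_of_real (indicator (B \<inter> cball 0 1) y * (y \<bullet> z)) \<partial>L) = of_real c"
        unfolding c_def by (rule integral_complex_of_real)
      finally show ?thesis by simp
    qed
    have "char (E \<star> D) t = exp (\<i> * of_real (t * d)) * exp (\<integral>y. h y *\<^sub>R \<phi> y \<partial>L) * exp (\<integral>y. g y *\<^sub>R \<phi> y \<partial>L)"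
    proof -
      have "char E t = iexp (t * d) * exp (\<integral>y. h y *\<^sub>R \<phi> y \<partial>L)"
        unfolding E_def char_convolution[OF real_distribution_return D'] charD' char_return N' ..
      then show ?thesis unfolding char_convolution[OF E D] charD N by simp
    qed
    also have "\<dots> = exp (\<i> * of_real (t * d) + ((\<integral>y. h y *\<^sub>R \<phi> y \<partial>L) + (\<integral>y. g y *\<^sub>R \<phi> y \<partial>L)))"
      by (simp add: exp_add)
    also have "\<dots> = exp (of_real u * (\<i> * of_real (t * (\<gamma> \<bullet> z)) + ((\<integral>y. indicator B y *\<^sub>R \<phi> y \<partial>L) - \<i> * of_real (t * c))))"
      unfolding sum d_def by (rule arg_cong[where f=exp]) (simp add: algebra_simps)
    finally show "char (E \<star> D) t = exp (of_real u * (\<i> * of_real (t * (\<gamma> \<bullet> z)) + (\<integral>y. indicator B y *\<^sub>R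
      (iexp (t * (y \<bullet> z)) - 1 - \<i> * of_real (t * (y \<bullet> z)) * of_real (indicator (cball 0 1) y)) \<partial>L)))"
      unfolding comp .
  qed
qed

text \<open>Passing to the limit in the truncated laws by Levy's continuity theorem avoids any existence
  theorem for infinitely divisible laws of infinite activity.\<close>

lemma levy_projection_tail:
  fixes L :: "(real^'n) measure" and \<gamma> z :: "real^'n" and D :: "real measure" and u R v a \<kappa> :: real
  assumes L: "levy_measure L" and D: "real_distribution D"
    and char: "\<And>t. char D t = exp (of_real u * levy_exponent \<gamma> 0 L (t *\<^sub>R z))"
    and z: "norm z \<le> 1" and u: "0 < u" and R: "0 < R"
    and v: "0 < v" "v < u * (LINT y:cball 0 R|L. (y \<bullet> z)\<^sup>2)"
    and \<kappa>: "0 < \<kappa>" "\<kappa> \<le> 1 / 2" and a: "0 < a"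
    and large: "4 \<le> \<kappa>\<^sup>2 * (a\<^sup>2 / (2 * v))" and small: "R * (3 * a / v) \<le> \<kappa>\<^sup>2 / 40"
  shows "exp (- ((1 + 3 * \<kappa>) / (1 - \<kappa>)\<^sup>2 * (a\<^sup>2 / (2 * v)))) \<le> measure D {x. a \<le> \<bar>x\<bar>}"
proof -
  have sets_L[measurable_cong]: "sets L = sets borel" using L by (simp add: levy_measure_def)
  define A where "A n = {y::real^'n. 1 / real (Suc n) < norm y \<and> norm y \<le> R}" for n
  define B where "B n = {y::real^'n. 1 / real (Suc n) < norm y}" for n
  have [measurable]: "A n \<in> sets borel" "B n \<in> sets borel" for n
    unfolding A_def B_def by measurable
  define \<psi> where "\<psi> t y = iexp (t * (y \<bullet> z)) - 1 - \<i> * of_real (t * (y \<bullet> z)) * of_real (indicator (cball 0 1) y)"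
    for t and y :: "real^'n"
  have [measurable]: "cball (0::real^'n) r \<in> sets borel" for r by simp
  have [measurable]: "\<psi> t \<in> borel_measurable borel" for t unfolding \<psi>_def by measurable
  have inB: "\<forall>\<^sub>F n in sequentially. y \<in> B n" if "y \<noteq> 0" for y
  proof -
    have "(\<lambda>n. 1 / real (Suc n)) \<longlonglongrightarrow> 0" by (rule LIMSEQ_Suc[OF lim_1_over_n])
    then show ?thesis
      using that unfolding B_def by (auto dest: order_tendstoD(2)[where a="norm y"])
  qed
  have yz: "\<bar>y \<bullet> z\<bar> \<le> norm y" for y
    using Cauchy_Schwarz_ineq2[of y z] mult_left_mono[OF z, of "norm y"] by simp
  have sq: "(y \<bullet> z)\<^sup>2 \<le> (norm y)\<^sup>2" for y
    using power_mono[OF yz, of y 2] by simp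
  have bound2: "norm (indicator (cball 0 R) y * (y \<bullet> z)\<^sup>2) \<le> max 1 (R\<^sup>2) * min 1 (norm y ^ 2)" for y
  proof (cases "norm y \<le> R")
    case True
    have "(norm y)\<^sup>2 \<le> R\<^sup>2" using True by (intro power_mono) auto
    then have "(norm y)\<^sup>2 \<le> max 1 (R\<^sup>2) * min 1 (norm y ^ 2)"
      by (cases "norm y ^ 2 \<le> 1") (auto simp: min_def max_def mult_le_cancel_right1 intro: order_trans)
    then show ?thesis using sq[of y] True by simp
  qed auto
  have conv2: "(\<lambda>n. \<integral>y. indicator (A n) y * (y \<bullet> z)\<^sup>2 \<partial>L) \<longlonglongrightarrow> (\<integral>y. indicator (cball 0 R) y * (y \<bullet> z)\<^sup>2 \<partial>L)"
  proof (rule integral_dominated_convergence[where w="\<lambda>y. indicator (cball 0 R) y * (y \<bullet> z)\<^sup>2"])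
    show "integrable L (\<lambda>y. indicator (cball 0 R) y * (y \<bullet> z)\<^sup>2)"
      by (rule levy_measure_integrable[OF L _ bound2]) measurable
    show "AE y in L. (\<lambda>n. indicator (A n) y * (y \<bullet> z)\<^sup>2) \<longlonglongrightarrow> indicator (cball 0 R) y * (y \<bullet> z)\<^sup>2"
    proof (rule AE_I2)
      fix y :: "real^'n"
      show "(\<lambda>n. indicator (A n) y * (y \<bullet> z)\<^sup>2) \<longlonglongrightarrow> indicator (cball 0 R) y * (y \<bullet> z)\<^sup>2"
      proof (cases "y = 0")
        case False
        have "\<forall>\<^sub>F n in sequentially. indicator (A n) y * (y \<bullet> z)\<^sup>2 = indicator (cball 0 R) y * (y \<bullet> z)\<^sup>2"
          using inB[OF False] by eventually_elim (auto simp: A_def B_def indicator_def)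
        then show ?thesis by (rule tendsto_eventually)
      qed simp
    qed
  qed (auto simp: A_def indicator_def)
  \<comment> \<open>The strict inequality in the hypothesis on \<open>v\<close> lets a truncation at
    a positive level already carry variance above \<open>v\<close>.\<close>
  have "\<forall>\<^sub>F n in sequentially. v < u * (\<integral>y. indicator (A n) y * (y \<bullet> z)\<^sup>2 \<partial>L)"
    using order_tendstoD(1)[OF tendsto_mult_left[OF conv2, of u]] v(2)
    by (simp add: set_lebesgue_integral_def)
  then obtain n0 where n0: "\<And>n. n0 \<le> n \<Longrightarrow> v < u * (\<integral>y. indicator (A n) y * (y \<bullet> z)\<^sup>2 \<partial>L)"
    by (auto simp: eventually_sequentially)
  let ?p = "exp (- ((1 + 3 * \<kappa>) / (1 - \<kappa>)\<^sup>2 * (a\<^sup>2 / (2 * v))))"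
  have "\<exists>W. real_distribution W \<and> (\<forall>t. char W t = exp (of_real u * (\<i> * of_real (t * (\<gamma> \<bullet> z)) +
      (\<integral>y. indicator (B (n + n0)) y *\<^sub>R \<psi> t y \<partial>L)))) \<and> ?p \<le> measure W {x. a \<le> \<bar>x\<bar>}" for n
  proof -
    have v': "v \<le> u * (\<integral>y. indicator {y. 1 / real (Suc (n + n0)) < norm y \<and> norm y \<le> R} y * (y \<bullet> z)\<^sup>2 \<partial>L)"
      using n0[of "n + n0"] by (simp add: A_def)
    show ?thesis
      unfolding \<psi>_def B_def
      by (rule truncated_levy_law[OF L z u _ R v(1) v' \<kappa> a large small, where \<gamma>=\<gamma>]) auto
  qed
  then obtain W where W: "\<And>n. real_distribution (W n)"
    and charW: "\<And>n t. char (W n) t = exp (of_real u * (\<i> * of_real (t * (\<gamma> \<bullet> z)) +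
      (\<integral>y. indicator (B (n + n0)) y *\<^sub>R \<psi> t y \<partial>L)))"
    and tail: "\<And>n. ?p \<le> measure (W n) {x. a \<le> \<bar>x\<bar>}"
    by metis
  have conv: "(\<lambda>n. \<integral>y. indicator (B n) y *\<^sub>R \<psi> t y \<partial>L) \<longlonglongrightarrow> (\<integral>y. \<psi> t y \<partial>L)" for t
  proof (rule integral_dominated_convergence[where w="\<lambda>y. norm (\<psi> t y)"])
    have "integrable L (\<psi> t)"
      unfolding \<psi>_def by (rule levy_measure_integrable[OF L _ levy_integrand_bound[OF z]]) measurable
    then show "integrable L (\<lambda>y. norm (\<psi> t y))" by (rule integrable_norm)
    show "AE y in L. (\<lambda>n. indicator (B n) y *\<^sub>R \<psi> t y) \<longlonglongrightarrow> \<psi> t y"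
    proof (rule AE_I2)
      fix y :: "real^'n"
      show "(\<lambda>n. indicator (B n) y *\<^sub>R \<psi> t y) \<longlonglongrightarrow> \<psi> t y"
      proof (cases "y = 0")
        case False
        have "\<forall>\<^sub>F n in sequentially. indicator (B n) y *\<^sub>R \<psi> t y = \<psi> t y"
          using inB[OF False] by eventually_elim auto
        then show ?thesis by (rule tendsto_eventually)
      qed (simp add: \<psi>_def)
    qed
  qed (auto simp: indicator_def)
  have charD: "char D t = exp (of_real u * (\<i> * of_real (t * (\<gamma> \<bullet> z)) + (\<integral>y. \<psi> t y \<partial>L)))" for t
    unfolding char levy_exponent_def \<psi>_def by (simp add: inner_commute)
  have "weak_conv_m W D"
  proof (rule levy_continuity[OF W D])
    fix t
    show "(\<lambda>n. char (W n) t) \<longlonglongrightarrow> char D t"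
      unfolding charW charD by (intro tendsto_intros LIMSEQ_ignore_initial_segment conv)
  qed
  then show ?thesis by (rule weak_conv_tail_lower_bound[OF W D _ tail])
qed

section \<open>Increments over a block of geometric times\<close>

text \<open>Stationarity reduces the increment to \<open>X (s - r)\<close>; taking the inner product
  with \<open>z\<close> in the unit ball can only lower the norm, so the one-dimensional tail bound
  transfers.\<close>

lemma levy_increment_tail:
  fixes X :: "real \<Rightarrow> 'w \<Rightarrow> real^'n"
  assumes lp: "levy_process M X \<gamma> 0 L" and r: "0 \<le> r" "r < s"
    and z: "norm z \<le> 1" and R: "0 < R"
    and v: "0 < v" "v < (s - r) * (LINT y:cball 0 R|L. (y \<bullet> z)\<^sup>2)"
    and \<kappa>: "0 < \<kappa>" "\<kappa> \<le> 1 / 2" and a: "0 < a"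
    and large: "4 \<le> \<kappa>\<^sup>2 * (a\<^sup>2 / (2 * v))" and small: "R * (3 * a / v) \<le> \<kappa>\<^sup>2 / 40"
  shows "exp (- ((1 + 3 * \<kappa>) / (1 - \<kappa>)\<^sup>2 * (a\<^sup>2 / (2 * v))))
    \<le> measure M {\<omega> \<in> space M. a \<le> norm (X s \<omega> - X r \<omega>)}"
proof -
  interpret prob_space M using lp by (simp add: levy_process_def)
  have L: "levy_measure L" using lp by (simp add: levy_process_def)
  have X[measurable]: "X t \<in> borel_measurable M" if "0 \<le> t" for t
  proof -
    have "\<forall>t\<ge>0. X t \<in> borel_measurable M" using lp unfolding levy_process_def by (elim conjE)
    then show ?thesis using that by blast
  qed
  define u where "u = s - r"
  have u: "0 < u" using r by (simp add: u_def)
  have stat: "distr M borel (\<lambda>\<omega>. X (r + u) \<omega> - X r \<omega>) = distr M borel (X u)"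
  proof -
    have "\<forall>s t. 0 \<le> s \<and> 0 \<le> t \<longrightarrow> distr M borel (\<lambda>\<omega>. X (s + t) \<omega> - X s \<omega>) = distr M borel (X t)"
      using lp unfolding levy_process_def by (elim conjE)
    then show ?thesis using r u by simp
  qed
  have [measurable]: "X u \<in> borel_measurable M" "X r \<in> borel_measurable M" "X s \<in> borel_measurable M"
    using X r u by auto
  define D where "D = distr M borel (\<lambda>\<omega>. X u \<omega> \<bullet> z)"
  have D: "real_distribution D"
    unfolding D_def by (rule real_distribution_distr) measurable
  have char: "char D t = exp (of_real u * levy_exponent \<gamma> 0 L (t *\<^sub>R z))" for t
  proof -
    have "char D t = (CLINT \<omega>|M. exp (\<i> * complex_of_real ((t *\<^sub>R z) \<bullet> X u \<omega>)))"
      unfolding char_def D_def by (subst integral_distr) (auto simp: inner_commute)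
    also have "\<dots> = exp (of_real u * levy_exponent \<gamma> 0 L (t *\<^sub>R z))"
    proof -
      have "\<forall>t\<ge>0. \<forall>z. integral\<^sup>L M (\<lambda>\<omega>. exp (\<i> * complex_of_real (z \<bullet> X t \<omega>)))
          = exp (complex_of_real t * levy_exponent \<gamma> 0 L z)"
        using lp unfolding levy_process_def by (elim conjE)
      then show ?thesis using less_imp_le[OF u] by blast
    qed
    finally show ?thesis .
  qed
  have "exp (- ((1 + 3 * \<kappa>) / (1 - \<kappa>)\<^sup>2 * (a\<^sup>2 / (2 * v)))) \<le> measure D {x. a \<le> \<bar>x\<bar>}"
    by (rule levy_projection_tail[OF L D char z u R v(1) v(2)[folded u_def] \<kappa> a large small])
  also have "\<dots> = measure M {\<omega> \<in> space M. a \<le> \<bar>X u \<omega> \<bullet> z\<bar>}"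
    unfolding D_def by (subst measure_distr) (auto intro!: arg_cong[where f="measure M"])
  also have "\<dots> \<le> measure M {\<omega> \<in> space M. a \<le> norm (X u \<omega>)}"
  proof (rule finite_measure_mono)
    have "\<bar>x \<bullet> z\<bar> \<le> norm x" for x
      using Cauchy_Schwarz_ineq2[of x z] mult_left_mono[OF z, of "norm x"] by simp
    then show "{\<omega> \<in> space M. a \<le> \<bar>X u \<omega> \<bullet> z\<bar>} \<subseteq> {\<omega> \<in> space M. a \<le> norm (X u \<omega>)}"
      by (auto intro: order_trans)
  qed measurable
  also have "\<dots> = measure (distr M borel (X u)) {x. a \<le> norm x}"
    by (subst measure_distr) (auto intro!: arg_cong[where f="measure M"])
  also have "\<dots> = measure (distr M borel (\<lambda>\<omega>. X (r + u) \<omega> - X r \<omega>)) {x. a \<le> norm x}"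
    unfolding stat ..
  also have "\<dots> = measure M {\<omega> \<in> space M. a \<le> norm (X s \<omega> - X r \<omega>)}"
    by (subst measure_distr) (auto simp: u_def intro!: arg_cong[where f="measure M"])
  finally show ?thesis .
qed

text \<open>By independence, missing all \<open>m\<close> levels has probability at most
  \<open>(1 - p)^m\<close>, hence at most \<open>exp (- m * p)\<close>. The case
  \<open>m = 0\<close> is set apart because the empty intersection need not be an event.\<close>

lemma levy_increments_hit:
  fixes X :: "real \<Rightarrow> 'w \<Rightarrow> real^'n" and s r :: "nat \<Rightarrow> real"
  assumes lp: "levy_process M X \<gamma> \<Sigma> L" and s: "0 \<le> s 0" "\<And>i. s i \<le> s (Suc i)" and p: "0 \<le> p"
    and tail: "\<And>i. i < m \<Longrightarrow> p \<le> measure M {\<omega> \<in> space M. r i \<le> norm (X (s (Suc i)) \<omega> - X (s i) \<omega>)}"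
  shows "1 - exp (- (real m * p))
    \<le> measure M {\<omega> \<in> space M. \<exists>i<m. r i \<le> norm (X (s (Suc i)) \<omega> - X (s i) \<omega>)}"
proof (cases "m = 0")
  case False
  interpret prob_space M using lp by (simp add: levy_process_def)
  have "s 0 \<le> s i" for i by (rule lift_Suc_mono_le[of s]) (use s in auto)
  then have s0: "0 \<le> s i" for i using s(1) order_trans by blast
  have [measurable]: "X (s i) \<in> borel_measurable M" for i
    using lp s0[of i] unfolding levy_process_def by blast
  define Y where "Y i \<omega> = X (s (Suc i)) \<omega> - X (s i) \<omega>" for i \<omega>
  have [measurable]: "Y i \<in> borel_measurable M" for i unfolding Y_def by measurable
  have ind: "indep_vars (\<lambda>_. borel) Y {..<m}"
  proof -
    have "\<forall>(n::nat) ts. 0 \<le> ts 0 \<and> (\<forall>i<n. ts i \<le> ts (Suc i)) \<longrightarrow>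
        indep_vars (\<lambda>_. borel) (\<lambda>i \<omega>. X (ts (Suc i)) \<omega> - X (ts i) \<omega>) {..<n}"
      using lp unfolding levy_process_def by (elim conjE)
    then show ?thesis unfolding Y_def using s by blast
  qed
  define A where "A i = {y::real^'n. norm y < r i}" for i
  have A[measurable]: "A i \<in> sets borel" for i unfolding A_def by measurable
  have "prob (\<Inter>i\<in>{..<m}. Y i -` A i \<inter> space M) = (\<Prod>i<m. prob (Y i -` A i \<inter> space M))"
    using False by (intro indep_varsD_finite[OF ind] A) (auto simp: lessThan_empty_iff)
  also have "\<dots> \<le> (\<Prod>i<m. exp (- p))"
  proof (rule prod_mono, safe)
    fix i assume "i < m"
    have "prob (Y i -` A i \<inter> space M) = 1 - prob {\<omega> \<in> space M. r i \<le> norm (Y i \<omega>)}"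
      by (subst prob_compl[symmetric], measurable) (auto simp: A_def intro!: arg_cong[where f=prob])
    also have "\<dots> \<le> 1 - p" using tail[OF \<open>i < m\<close>] by (simp add: Y_def)
    also have "\<dots> \<le> exp (- p)" using exp_ge_add_one_self[of "- p"] by simp
    finally show "prob (Y i -` A i \<inter> space M) \<le> exp (- p)" .
  qed simp
  also have "\<dots> = exp (- (real m * p))" by (simp add: exp_of_nat_mult[symmetric])
  finally have *: "prob (\<Inter>i\<in>{..<m}. Y i -` A i \<inter> space M) \<le> exp (- (real m * p))" .
  have "prob {\<omega> \<in> space M. \<exists>i<m. r i \<le> norm (Y i \<omega>)} = 1 - prob (\<Inter>i\<in>{..<m}. Y i -` A i \<inter> space M)"
  proof -
    have "(\<Inter>i\<in>{..<m}. Y i -` A i \<inter> space M) = space M - {\<omega> \<in> space M. \<exists>i<m. r i \<le> norm (Y i \<omega>)}"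
      using False by (auto simp: A_def) (metis lessThan_iff linorder_not_le)
    moreover have "{\<omega> \<in> space M. \<exists>i<m. r i \<le> norm (Y i \<omega>)} \<in> events" by measurable
    ultimately show ?thesis by (simp add: prob_compl)
  qed
  with * show ?thesis by (simp add: Y_def)
qed simp

text \<open>\<open>w\<close> is the logarithmic length of the block, and \<open>e\<close> serves
  both as the ratio of successive times and as the accuracy of the tail bound. The condition on
  \<open>\<kappa>\<close> collects the losses: \<open>(1 + 3 * e) / (1 - e)^2\<close> from the tail
  bound, \<open>(1 + e)^2\<close> from comparing values of \<open>h\<close>, and
  \<open>1 - e\<close> because an increment spans only this share of the time
  \<open>s (Suc j)\<close>. The condition on \<open>c\<close> pays for passing from increments to
  end points.\<close>

lemma levy_block_probability:
  fixes X :: "real \<Rightarrow> 'w \<Rightarrow> real^'n" and h :: "real \<Rightarrow> real" and c0 c lam e \<kappa> t w :: real and m :: nat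
  defines "A \<equiv> ln (1 / t)" and "s \<equiv> \<lambda>j. t * (1 / e) ^ (m + j)"
  assumes lp: "levy_process M X \<gamma> 0 L" and mono: "mono_on {0..} h"
    and c0: "0 < c0" and lam: "0 < lam" and e: "0 < e" "e \<le> 1 / 2"
    and c: "c0 * (1 + sqrt (2 * e)) \<le> c"
    and \<kappa>: "(1 + 3 * e) / (1 - e)\<^sup>2 * (c\<^sup>2 * (1 + e)\<^sup>2 / ((1 - e) * lam\<^sup>2)) \<le> \<kappa>"
    and t: "0 < t" and A: "4 \<le> A" and w: "0 \<le> w" "w \<le> A / 2"
    and hpos: "0 < h (1 / t * exp (- w))" and hle: "h (1 / t) \<le> (1 + e) * h (1 / t * exp (- w))"
    and m: "(1 / e) ^ (2 * m) \<le> exp w"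
    and V: "lam\<^sup>2 / 2 < V_fun L (sqrt (t * ln A) / h (1 / t)) * (h (1 / t))\<^sup>2"
    and large: "4 \<le> e\<^sup>2 * (c\<^sup>2 * ln (A / 2) / lam\<^sup>2)"
    and small: "6 * c * (1 + e) / ((1 - e) * lam\<^sup>2) * (ln A * sqrt (e ^ m)) \<le> e\<^sup>2 / 40"
  shows "1 - exp (- (real m * exp (- (\<kappa> * ln A)))) \<le> measure M {\<omega> \<in> space M. \<exists>j\<le>m.
    c0 \<le> h (1 / s j) * norm (X (s j) \<omega>) / sqrt (s j * ln (ln (1 / s j)))}"
proof -
  interpret prob_space M using lp by (simp add: levy_process_def)
  define H where "H = h (1 / t)"
  define b where "b r = sqrt (r * ln (ln (1 / r))) / h (1 / r)" for r
  have c_pos: "0 < c" using c0 c e by (smt (verit) mult_pos_pos real_sqrt_ge_0_iff)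
  have e1: "e < 1" using e by simp
  have inv_e: "1 \<le> 1 / e" using e by simp
  have A_eq: "1 / t = exp A" using t by (simp add: A_def)
  have s_pos: "0 < s j" for j using t e by (simp add: s_def)
  have s_Suc: "s j = e * s (Suc j)" for j using e by (simp add: s_def)
  have s_mono: "s j \<le> s (Suc j)" for j
    unfolding s_Suc[of j] using s_pos[of "Suc j"] e by (simp add: mult_le_cancel_right1)
  have s_ge: "t / e ^ m \<le> s j" for j
  proof -
    have "t * ((1 / e) ^ m * 1) \<le> t * ((1 / e) ^ m * (1 / e) ^ j)"
      using inv_e t e by (intro mult_left_mono one_le_power) auto
    then show ?thesis by (simp add: s_def power_add power_divide)
  qed
  have s_ge_t: "t \<le> s j" for j
  proof -
    have "e ^ m \<le> 1" using e by (intro power_le_one) auto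
    then have "t * 1 \<le> t / e ^ m" using t e by (simp add: le_divide_eq mult_left_le)
    then show ?thesis using s_ge[of j] by simp
  qed
  have s_le: "s j \<le> t * exp w" if "j \<le> m" for j
  proof -
    have "(1 / e) ^ (m + j) \<le> (1 / e) ^ (2 * m)"
      using that inv_e by (intro power_increasing) auto
    then show ?thesis unfolding s_def using m t by (intro mult_left_mono) auto
  qed
  have inv_s: "1 / t * exp (- w) \<le> 1 / s j" "1 / s j \<le> 1 / t" if "j \<le> m" for j
  proof -
    have "1 / (t * exp w) \<le> 1 / s j"
      using s_le[OF that] s_pos t by (intro frac_le) auto
    then show "1 / t * exp (- w) \<le> 1 / s j" by (simp add: exp_minus field_simps)
    show "1 / s j \<le> 1 / t" using s_ge_t t s_pos by (intro frac_le) auto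
  qed
  have ln_s: "A / 2 \<le> ln (1 / s j)" "ln (1 / s j) \<le> A" if "j \<le> m" for j
  proof -
    have "ln (1 / t * exp (- w)) \<le> ln (1 / s j)"
      using inv_s(1)[OF that] s_pos t by (intro ln_mono) auto
    also have "ln (1 / t * exp (- w)) = A - w" unfolding A_eq by (simp add: exp_add[symmetric])
    finally show "A / 2 \<le> ln (1 / s j)" using w by simp
    show "ln (1 / s j) \<le> A" unfolding A_def using inv_s(2)[OF that] s_pos t by (intro ln_mono) auto
  qed
  \<comment> \<open>From \<open>4 \<le> A\<close> the iterated logarithm changes by at most a factor
    2 within the block, which gives the 2 in \<open>sqrt (2 * e)\<close>.\<close>
  have lnA2: "ln A / 2 \<le> ln (A / 2)"
  proof -
    have "A \<le> (A / 2)\<^sup>2" using A by (simp add: power2_eq_square)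
    then have "ln A \<le> ln ((A / 2)\<^sup>2)" using A by (intro ln_mono) auto
    also have "\<dots> = 2 * ln (A / 2)" using A by (simp add: ln_realpow)
    finally show ?thesis by simp
  qed
  have lnA: "0 < ln A" using A by simp
  have LL: "ln A / 2 \<le> ln (ln (1 / s j))" "ln (A / 2) \<le> ln (ln (1 / s j))" "ln (ln (1 / s j)) \<le> ln A" if "j \<le> m" for j
  proof -
    show *: "ln (A / 2) \<le> ln (ln (1 / s j))" using ln_s[OF that] A by (intro ln_mono) auto
    show "ln A / 2 \<le> ln (ln (1 / s j))" using * lnA2 by simp
    show "ln (ln (1 / s j)) \<le> ln A" using ln_s[OF that] A by (intro ln_mono) auto
  qed
  have LL_pos: "0 < ln (ln (1 / s j))" if "j \<le> m" for j using LL(1)[OF that] lnA by simp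
  have h_s: "H \<le> (1 + e) * h (1 / s j)" "0 < h (1 / s j)" "h (1 / s j) \<le> H" if "j \<le> m" for j
  proof -
    have *: "h (1 / t * exp (- w)) \<le> h (1 / s j)"
      using inv_s(1)[OF that] t s_pos[of j] by (intro mono_onD[OF mono]) auto
    show "0 < h (1 / s j)" using * hpos by simp
    show "H \<le> (1 + e) * h (1 / s j)"
      unfolding H_def by (rule order_trans[OF hle mult_left_mono[OF *]]) (use e in simp)
    show "h (1 / s j) \<le> H"
      unfolding H_def using inv_s(2)[OF that] t s_pos[of j] by (intro mono_onD[OF mono]) auto
  qed
  have H: "0 < H" using h_s(2,3)[of 0] by simp
  have b_pos: "0 < b (s j)" if "j \<le> m" for j
    using s_pos[of j] LL_pos[OF that] h_s(2)[OF that] by (simp add: b_def)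
  define R where "R = sqrt (t * ln A) / H"
  have R: "0 < R" using t lnA H by (simp add: R_def)
  \<comment> \<open>Whether or not the supremum in \<open>V\<close> is attained, the strict
    inequality supplies a direction \<open>z\<close>; the same one serves all increments of the
    block.\<close>
  have "\<exists>z\<in>cball 0 1. lam\<^sup>2 / (2 * H\<^sup>2) < (LINT y:cball 0 R|L. (y \<bullet> z)\<^sup>2)"
  proof (rule ccontr)
    assume "\<not> ?thesis"
    then have "V_fun L R \<le> lam\<^sup>2 / (2 * H\<^sup>2)"
      unfolding V_fun_def by (intro cSUP_least) (auto simp: not_less)
    then have "V_fun L R * H\<^sup>2 \<le> lam\<^sup>2 / (2 * H\<^sup>2) * H\<^sup>2" by (rule mult_right_mono) simp
    then show False using V H by (simp add: R_def H_def)
  qed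
  then obtain z where z: "norm z \<le> 1" "lam\<^sup>2 / (2 * H\<^sup>2) < (LINT y:cball 0 R|L. (y \<bullet> z)\<^sup>2)"
    by auto
  have tail: "exp (- (\<kappa> * ln A)) \<le> prob {\<omega> \<in> space M. c * b (s (Suc j)) \<le> norm (X (s (Suc j)) \<omega> - X (s j) \<omega>)}"
    if "j < m" for j
  proof -
    have j: "Suc j \<le> m" using that by simp
    define s' where "s' = s (Suc j)"
    define g where "g = h (1 / s')"
    define l where "l = ln (ln (1 / s'))"
    define a where "a = c * b s'"
    \<comment> \<open>A variance strictly below that of the truncated jumps in direction
      \<open>z\<close>, chosen so that \<open>a^2 / (2 * v)\<close> becomes an explicit multiple of
      the iterated logarithm.\<close>
    define v where "v = (s' - s j) * (lam\<^sup>2 / (2 * H\<^sup>2))"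
    have s': "0 < s'" using s_pos by (simp add: s'_def)
    have l: "0 < l" "l \<le> ln A" "ln (A / 2) \<le> l" using LL[OF j] LL_pos[OF j] by (auto simp: l_def s'_def)
    have g: "0 < g" "H \<le> (1 + e) * g" "g \<le> H" using h_s[OF j] by (auto simp: g_def s'_def)
    have u: "s' - s j = (1 - e) * s'" unfolding s_Suc[of j] s'_def by (simp add: algebra_simps)
    have v: "0 < v" unfolding v_def u using s' e1 lam H by simp
    have a: "0 < a" using c_pos b_pos[OF j] by (simp add: a_def s'_def)
    have a2v: "a\<^sup>2 / (2 * v) = c\<^sup>2 * l / ((1 - e) * lam\<^sup>2) * (H / g)\<^sup>2"
    proof -
      have "a\<^sup>2 = c\<^sup>2 * (s' * l) / g\<^sup>2"
        using s' l by (simp add: a_def b_def l_def g_def power_mult_distrib power_divide)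
      moreover have "c\<^sup>2 * (s' * l) / g\<^sup>2 / (2 * (f * s' * (lam\<^sup>2 / (2 * H\<^sup>2)))) = c\<^sup>2 * l / (f * lam\<^sup>2) * (H / g)\<^sup>2"
        if "0 < f" for f
        using that s' lam H g by (simp add: power_divide field_simps)
      ultimately show ?thesis unfolding v_def u using e1 by simp
    qed
    have Hg: "H / g \<le> 1 + e" "1 \<le> H / g" using g by (auto simp: divide_le_eq le_divide_eq)
    have upper: "(1 + 3 * e) / (1 - e)\<^sup>2 * (a\<^sup>2 / (2 * v)) \<le> \<kappa> * ln A"
    proof -
      have "c\<^sup>2 * l / ((1 - e) * lam\<^sup>2) * (H / g)\<^sup>2 \<le> c\<^sup>2 * ln A / ((1 - e) * lam\<^sup>2) * (1 + e)\<^sup>2"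
        using l Hg e1 lam g H lnA by (intro mult_mono divide_right_mono mult_left_mono power_mono) auto
      then have "(1 + 3 * e) / (1 - e)\<^sup>2 * (a\<^sup>2 / (2 * v)) \<le> (1 + 3 * e) / (1 - e)\<^sup>2 * (c\<^sup>2 * ln A / ((1 - e) * lam\<^sup>2) * (1 + e)\<^sup>2)"
        unfolding a2v using e by (intro mult_left_mono) auto
      also have "\<dots> = (1 + 3 * e) / (1 - e)\<^sup>2 * (c\<^sup>2 * (1 + e)\<^sup>2 / ((1 - e) * lam\<^sup>2)) * ln A"
        by simp
      also have "\<dots> \<le> \<kappa> * ln A" using \<kappa> lnA by (intro mult_right_mono) auto
      finally show ?thesis .
    qed
    have lower: "4 \<le> e\<^sup>2 * (a\<^sup>2 / (2 * v))"
    proof -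
      have "c\<^sup>2 * ln (A / 2) / lam\<^sup>2 \<le> c\<^sup>2 * l / lam\<^sup>2"
        using l by (intro divide_right_mono mult_left_mono) auto
      also have "\<dots> \<le> c\<^sup>2 * l / ((1 - e) * lam\<^sup>2)"
        using l e e1 lam by (intro divide_left_mono) (auto simp: mult_le_cancel_right1)
      also have "\<dots> \<le> c\<^sup>2 * l / ((1 - e) * lam\<^sup>2) * (H / g)\<^sup>2"
      proof -
        have "1 \<le> (H / g)\<^sup>2" using Hg(2) by (rule one_le_power)
        then show ?thesis using l e1 lam mult_left_mono[of 1 "(H / g)\<^sup>2" "c\<^sup>2 * l / ((1 - e) * lam\<^sup>2)"] by simp
      qed
      finally have "e\<^sup>2 * (c\<^sup>2 * ln (A / 2) / lam\<^sup>2) \<le> e\<^sup>2 * (a\<^sup>2 / (2 * v))"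
        unfolding a2v by (rule mult_left_mono) simp
      then show ?thesis using large by simp
    qed
    \<comment> \<open>Up to constants the left side is at most \<open>ln A * sqrt (t / s')\<close>.
      As the indices start at \<open>m\<close>, \<open>t / s' \<le> e ^ m\<close>, which makes up
      for the logarithm; for times near \<open>t\<close> itself nothing would.\<close>
    have sm: "R * (3 * a / v) \<le> e\<^sup>2 / 40"
    proof -
      have sq: "sqrt (s' * l) / s' = sqrt l / sqrt s'"
        using s' by (simp add: real_sqrt_mult field_simps)
      have "R * (3 * a / v) = 6 * c / ((1 - e) * lam\<^sup>2) * (H / g) * (sqrt (t * ln A) * (sqrt (s' * l) / s'))"
      proof -
        have "p / H * (3 * (c * (q / g)) / (f * s' * (lam\<^sup>2 / (2 * H\<^sup>2)))) = 6 * c / (f * lam\<^sup>2) * (H / g) * (p * (q / s'))"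
          if "0 < f" for f p q
          using that s' lam H g by (simp add: power2_eq_square field_simps)
        then show ?thesis
          unfolding R_def a_def b_def v_def u l_def[symmetric] g_def[symmetric] using e1 by simp
      qed
      also have "\<dots> = 6 * c / ((1 - e) * lam\<^sup>2) * (H / g) * (sqrt (ln A * l) * sqrt (t / s'))"
        unfolding sq by (simp add: real_sqrt_mult real_sqrt_divide)
      also have "\<dots> \<le> 6 * c / ((1 - e) * lam\<^sup>2) * (1 + e) * (ln A * sqrt (e ^ m))"
      proof (intro mult_mono)
        have "sqrt (ln A * l) \<le> sqrt (ln A * ln A)" using l lnA by (intro real_sqrt_le_mono mult_left_mono) auto
        then show "sqrt (ln A * l) \<le> ln A" using lnA by simp
        have "t / s' \<le> e ^ m" using s_ge[of "Suc j"] s' e t by (simp add: s'_def field_simps)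
        then show "sqrt (t / s') \<le> sqrt (e ^ m)" by simp
      qed (use Hg g H e e1 c_pos lam l lnA t s' in auto)
      also have "\<dots> \<le> e\<^sup>2 / 40" using small by simp
      finally show ?thesis .
    qed
    have v': "v < (s' - s j) * (LINT y:cball 0 R|L. (y \<bullet> z)\<^sup>2)"
      unfolding v_def u using z(2) s' e1 by (intro mult_strict_left_mono) auto
    have lt: "s j < s'" using u s' e1 by (smt (verit) mult_pos_pos)
    have "exp (- (\<kappa> * ln A)) \<le> exp (- ((1 + 3 * e) / (1 - e)\<^sup>2 * (a\<^sup>2 / (2 * v))))"
      using upper by simp
    also have "\<dots> \<le> prob {\<omega> \<in> space M. a \<le> norm (X s' \<omega> - X (s j) \<omega>)}"
      by (rule levy_increment_tail[OF lp less_imp_le[OF s_pos] lt z(1) R v v' e a lower sm])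
    finally show ?thesis by (simp add: a_def s'_def)
  qed
  have X_meas[measurable]: "X (s j) \<in> borel_measurable M" for j
    using lp less_imp_le[OF s_pos[of j]] unfolding levy_process_def by blast
  have "1 - exp (- (real m * exp (- (\<kappa> * ln A))))
      \<le> prob {\<omega> \<in> space M. \<exists>j<m. c * b (s (Suc j)) \<le> norm (X (s (Suc j)) \<omega> - X (s j) \<omega>)}"
    by (rule levy_increments_hit[where s=s and r="\<lambda>j. c * b (s (Suc j))", OF lp less_imp_le[OF s_pos] s_mono _ tail]) auto
  also have "\<dots> \<le> prob {\<omega> \<in> space M. \<exists>j\<le>m. c0 \<le> h (1 / s j) * norm (X (s j) \<omega>) / sqrt (s j * ln (ln (1 / s j)))}"
  proof (rule finite_measure_mono, safe)
    fix \<omega> j assume "j < m" and big: "c * b (s (Suc j)) \<le> norm (X (s (Suc j)) \<omega> - X (s j) \<omega>)"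
    then have j: "Suc j \<le> m" "j \<le> m" by auto
    have conv: "c0 \<le> h (1 / s i) * norm (X (s i) \<omega>) / sqrt (s i * ln (ln (1 / s i)))"
      if "i \<le> m" "c0 * b (s i) \<le> norm (X (s i) \<omega>)" for i
    proof -
      have "0 < sqrt (s i * ln (ln (1 / s i)))" using s_pos LL_pos[OF that(1)] by simp
      then show ?thesis using that(2) h_s(2)[OF that(1)] by (simp add: b_def field_simps)
    qed
    \<comment> \<open>The \<open>e\<close> is the ratio of the times and the 2 comes from the
      iterated logarithms; the denominator \<open>h (1 / s)\<close> is no larger at the later time,
      so it only helps.\<close>
    have bb: "b (s j) \<le> sqrt (2 * e) * b (s (Suc j))"
    proof -
      have "s j * ln (ln (1 / s j)) \<le> (e * s (Suc j)) * (2 * ln (ln (1 / s (Suc j))))"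
        unfolding s_Suc[of j, symmetric] using LL(3)[OF j(2)] LL(1)[OF j(1)] s_pos[of j]
        by (intro mult_left_mono) auto
      also have "\<dots> = 2 * e * (s (Suc j) * ln (ln (1 / s (Suc j))))" by simp
      finally have 1: "sqrt (s j * ln (ln (1 / s j))) \<le> sqrt (2 * e) * sqrt (s (Suc j) * ln (ln (1 / s (Suc j))))"
        by (metis real_sqrt_le_mono real_sqrt_mult)
      have 2: "h (1 / s (Suc j)) \<le> h (1 / s j)"
        using s_mono[of j] s_pos[of j] s_pos[of "Suc j"] by (intro mono_onD[OF mono] frac_le) auto
      have "b (s j) \<le> (sqrt (2 * e) * sqrt (s (Suc j) * ln (ln (1 / s (Suc j))))) / h (1 / s (Suc j))"
        unfolding b_def using 1 2 h_s(2)[OF j(1)] s_pos LL_pos[OF j(1)] e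
        by (intro frac_le) (auto intro!: mult_nonneg_nonneg less_imp_le)
      then show ?thesis by (simp add: b_def)
    qed
    \<comment> \<open>Were the process below \<open>c0 * b\<close> at both end points, the increment
      would stay below \<open>c * b (s (Suc j))\<close>. Either end point may be the large one,
      hence indices from 0 to \<open>m\<close>.\<close>
    have "c0 * b (s j) + c0 * b (s (Suc j)) \<le> c0 * (1 + sqrt (2 * e)) * b (s (Suc j))"
      using mult_left_mono[OF bb, of c0] c0 by (simp add: algebra_simps)
    also have "\<dots> \<le> c * b (s (Suc j))"
      using c b_pos[OF j(1)] by (intro mult_right_mono) auto
    also have "\<dots> \<le> norm (X (s (Suc j)) \<omega>) + norm (X (s j) \<omega>)"
      using big norm_triangle_ineq4[of "X (s (Suc j)) \<omega>" "X (s j) \<omega>"] by simp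
    finally consider "c0 * b (s j) \<le> norm (X (s j) \<omega>)" | "c0 * b (s (Suc j)) \<le> norm (X (s (Suc j)) \<omega>)"
      by linarith
    then show "\<exists>j\<le>m. c0 \<le> h (1 / s j) * norm (X (s j) \<omega>) / sqrt (s j * ln (ln (1 / s j)))"
      using conv j by cases blast+
  qed measurable
  finally show ?thesis .
qed

section \<open>Asymptotics of the block parameters\<close>

text \<open>The class condition compares \<open>h\<close> at a point with \<open>h\<close> further
  out, whereas here the comparison runs downwards from \<open>exp A\<close>. Starting at
  \<open>y = exp (A - A powr \<sigma>)\<close>, the point \<open>y * f_tau \<tau> y\<close> reaches
  at least \<open>exp A\<close> for large \<open>A\<close> because \<open>\<sigma> < \<tau>\<close>,
  and monotonicity does the rest.\<close>

lemma class_H_comparison: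
  fixes h :: "real \<Rightarrow> real" and q \<sigma> \<tau> e :: real
  assumes h: "class_H q h" and \<tau>: "0 < \<sigma>" "\<sigma> < \<tau>" "\<tau> < 1 - q" "\<tau> < 1" and e: "0 < e" "e < 1"
  shows "\<forall>\<^sub>F A in at_top. 0 < h (exp A * exp (- (A powr \<sigma>))) \<and>
    h (exp A) \<le> (1 + e) * h (exp A * exp (- (A powr \<sigma>)))"
proof -
  have lim: "((\<lambda>x. h (x * f_tau \<tau> x) / h x) \<longlongrightarrow> 1) at_top"
    using h \<tau> by (simp add: class_H_def)
  have mono: "mono_on {0..} h" and nonneg: "\<And>x. 0 \<le> x \<Longrightarrow> 0 \<le> h x"
    using h by (auto simp: class_H_def class_H1_def)
  have ev: "\<forall>\<^sub>F x in at_top. 0 < h (x * f_tau \<tau> x) / h x \<and> h (x * f_tau \<tau> x) / h x < 1 + e"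
    using e by (intro eventually_conj order_tendstoD[OF lim]) auto
  have "filterlim (\<lambda>A::real. exp (A - A powr \<sigma>)) at_top at_top"
    using \<tau> by real_asymp
  then have ev': "\<forall>\<^sub>F A in at_top. 0 < h (exp (A - A powr \<sigma>) * f_tau \<tau> (exp (A - A powr \<sigma>))) / h (exp (A - A powr \<sigma>)) \<and>
      h (exp (A - A powr \<sigma>) * f_tau \<tau> (exp (A - A powr \<sigma>))) / h (exp (A - A powr \<sigma>)) < 1 + e"
    using eventually_compose_filterlim[OF ev] by blast
  have "\<forall>\<^sub>F A::real in at_top. A powr \<sigma> \<le> (A - A powr \<sigma>) powr \<tau>"
    using \<tau> by real_asymp
  with ev' show ?thesis
  proof eventually_elim
    case (elim A)
    define y where "y = exp (A - A powr \<sigma>)"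
    have y: "exp A * exp (- (A powr \<sigma>)) = y" by (simp add: y_def exp_add[symmetric])
    \<comment> \<open>A zero of \<open>h\<close> would make the quotient 0 by the convention for
      division, against its positivity.\<close>
    have hy: "0 < h y"
      using elim nonneg[of y] by (cases "h y = 0") (auto simp: y_def)
    have "A \<le> (A - A powr \<sigma>) + (A - A powr \<sigma>) powr \<tau>" using elim by simp
    then have "exp A \<le> exp ((A - A powr \<sigma>) + (A - A powr \<sigma>) powr \<tau>)" by simp
    also have "\<dots> = y * f_tau \<tau> y" by (simp add: y_def f_tau_def exp_add)
    finally have "h (exp A) \<le> h (y * f_tau \<tau> y)"
      by (intro mono_onD[OF mono]) (auto intro: order_trans[OF exp_ge_zero])
    also have "\<dots> \<le> (1 + e) * h y"
      using elim hy by (simp add: y_def[symmetric] divide_less_eq)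
    finally show ?case unfolding y using hy by simp
  qed
qed

text \<open>As \<open>e\<close> tends to 0 from above, the two left sides tend to \<open>c0\<close>
  and \<open>c^2 / lam^2\<close>, and the hypotheses are strict.\<close>

lemma block_parameters_exist:
  fixes c0 c lam \<kappa> :: real
  assumes "0 < c0" "c0 < c" "0 < lam" "c\<^sup>2 / lam\<^sup>2 < \<kappa>"
  obtains e where "0 < e" "e \<le> 1 / 2" "c0 * (1 + sqrt (2 * e)) \<le> c"
    "(1 + 3 * e) / (1 - e)\<^sup>2 * (c\<^sup>2 * (1 + e)\<^sup>2 / ((1 - e) * lam\<^sup>2)) \<le> \<kappa>"
proof -
  have "((\<lambda>e. c0 * (1 + sqrt (2 * e))) \<longlongrightarrow> c0 * (1 + sqrt (2 * 0))) (at_right 0)"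
    by (intro tendsto_intros)
  then have 1: "\<forall>\<^sub>F e in at_right 0. c0 * (1 + sqrt (2 * e)) < c"
    using assms by (intro order_tendstoD(2)) auto
  have "((\<lambda>e. (1 + 3 * e) / (1 - e)\<^sup>2 * (c\<^sup>2 * (1 + e)\<^sup>2 / ((1 - e) * lam\<^sup>2))) \<longlongrightarrow>
      (1 + 3 * 0) / (1 - 0)\<^sup>2 * (c\<^sup>2 * (1 + 0)\<^sup>2 / ((1 - 0) * lam\<^sup>2))) (at_right 0)"
    using assms by (intro tendsto_intros) auto
  then have 2: "\<forall>\<^sub>F e in at_right 0. (1 + 3 * e) / (1 - e)\<^sup>2 * (c\<^sup>2 * (1 + e)\<^sup>2 / ((1 - e) * lam\<^sup>2)) < \<kappa>"
    using assms by (intro order_tendstoD(2)) auto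
  have 3: "\<forall>\<^sub>F e in at_right 0. 0 < e \<and> e < (1 / 2 :: real)"
    by (auto simp: eventually_at_right_field intro!: exI[of _ "1/2"])
  have "\<exists>e::real. (c0 * (1 + sqrt (2 * e)) < c \<and> (1 + 3 * e) / (1 - e)\<^sup>2 * (c\<^sup>2 * (1 + e)\<^sup>2 / ((1 - e) * lam\<^sup>2)) < \<kappa>) \<and>
      0 < e \<and> e < 1 / 2"
    by (rule eventually_happens'[OF trivial_limit_at_right_real eventually_conj[OF eventually_conj[OF 1 2] 3]])
  then show thesis using that by force
qed

text \<open>With \<open>A = ln (1 / t)\<close> and of order \<open>A powr \<sigma>\<close>
  increments, each large with probability at least \<open>A powr (- \<kappa>)\<close>, the chance of
  missing is at most the exponential of minus a quantity of order
  \<open>A powr (\<sigma> - \<kappa>)\<close>, which tends to 0. A finite \<open>S\<close> keeps the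
  event measurable.\<close>

lemma levy_hit_probability:
  fixes X :: "real \<Rightarrow> 'w \<Rightarrow> real^'n" and h :: "real \<Rightarrow> real" and q lam c0 T \<delta> :: real
  assumes lp: "levy_process M X \<gamma> 0 L" and q: "0 \<le> q" "q < 1" and h: "class_H q h"
    and lam: "0 < lam" and c0: "0 < c0" "c0 < sqrt (1 - q) * lam" and T: "0 < T" and \<delta>: "0 < \<delta>"
    and V: "\<And>l. 0 < l \<Longrightarrow> l < lam \<Longrightarrow>
      \<exists>\<^sub>F t in at_right 0. l\<^sup>2 / 2 < V_fun L (sqrt (t * ln (ln (1 / t))) / h (1 / t)) * (h (1 / t))\<^sup>2"
  obtains S where "finite S" "S \<subseteq> {0<..<T}"
    "1 - \<delta> \<le> measure M {\<omega> \<in> space M. \<exists>s\<in>S. c0 \<le> h (1 / s) * norm (X s \<omega>) / sqrt (s * ln (ln (1 / s)))}"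
proof -
  define c where "c = (c0 + sqrt (1 - q) * lam) / 2"
  have c: "c0 < c" "c < sqrt (1 - q) * lam" "0 < c"
  proof -
    have "x < (x + y) / 2 \<and> (x + y) / 2 < y \<and> 0 < (x + y) / 2" if "0 < x" "x < y" for x y :: real
      using that by simp
    then show "c0 < c" "c < sqrt (1 - q) * lam" "0 < c" unfolding c_def using c0 by blast+
  qed
  have "c\<^sup>2 < (sqrt (1 - q) * lam)\<^sup>2" using c by (intro power_strict_mono) auto
  then have cq: "c\<^sup>2 / lam\<^sup>2 < 1 - q" using lam q by (simp add: power_mult_distrib divide_less_eq)
  \<comment> \<open>Five equal gaps between \<open>c^2 / lam^2\<close> and \<open>1 - q\<close> make
    room for four exponents: \<open>\<mu>\<close> for the loss from \<open>lam\<close> to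
    \<open>l\<close>, \<open>\<kappa>\<close> for the probability, \<open>\<sigma>\<close> for the
    length of the block and \<open>\<tau>\<close> for the regularity of \<open>h\<close>.\<close>
  define r where "r = (1 - q - c\<^sup>2 / lam\<^sup>2) / 5"
  have r: "0 < r" using cq by (simp add: r_def)
  define \<mu> \<kappa> \<sigma> \<tau> where "\<mu> = c\<^sup>2 / lam\<^sup>2 + r" and "\<kappa> = c\<^sup>2 / lam\<^sup>2 + 2 * r"
    and "\<sigma> = c\<^sup>2 / lam\<^sup>2 + 3 * r" and "\<tau> = c\<^sup>2 / lam\<^sup>2 + 4 * r"
  have ord: "0 < c\<^sup>2 / lam\<^sup>2" "c\<^sup>2 / lam\<^sup>2 < \<mu>" "\<mu> < \<kappa>" "\<kappa> < \<sigma>" "\<sigma> < \<tau>" "\<tau> < 1 - q"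
    using r lam c by (auto simp: \<mu>_def \<kappa>_def \<sigma>_def \<tau>_def) (simp add: r_def field_simps)
  \<comment> \<open>The assumption on \<open>V\<close> is available at levels below
    \<open>lam\<close>; this level makes \<open>c^2 / l^2\<close> equal to \<open>\<mu>\<close>,
    still below \<open>\<kappa>\<close>.\<close>
  define l where "l = c / sqrt \<mu>"
  have l: "0 < l" using ord c by (simp add: l_def)
  have l2: "c\<^sup>2 / l\<^sup>2 = \<mu>" using ord c by (simp add: l_def power_divide)
  have "l < lam"
  proof -
    have "sqrt (c\<^sup>2 / lam\<^sup>2) < sqrt \<mu>" using ord by simp
    then have "c / lam < sqrt \<mu>" using c lam by (simp add: real_sqrt_divide)
    moreover have "0 < sqrt \<mu>" using ord by simp
    ultimately show ?thesis using lam by (simp add: l_def pos_divide_less_eq mult.commute)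
  qed
  obtain e where e: "0 < e" "e \<le> 1 / 2" "c0 * (1 + sqrt (2 * e)) \<le> c"
    "(1 + 3 * e) / (1 - e)\<^sup>2 * (c\<^sup>2 * (1 + e)\<^sup>2 / ((1 - e) * l\<^sup>2)) \<le> \<kappa>"
    using block_parameters_exist[OF c0(1) c(1) l, of \<kappa>] l2 ord by metis
  define k where "k = ln (1 / e)"
  have k: "0 < k" using e by (simp add: k_def)
  have ek: "1 / e = exp k" "e = exp (- k)" using e by (simp_all add: k_def exp_minus inverse_eq_divide)
  define K where "K = 6 * c * (1 + e) / ((1 - e) * l\<^sup>2)"
  have K: "0 < K" using e c l by (simp add: K_def)
  \<comment> \<open>The times have indices from \<open>m\<close> to \<open>2 * m\<close> and
    logarithmic step \<open>k\<close>, so \<open>2 * m * k\<close> must not exceed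
    \<open>A powr \<sigma>\<close>.\<close>
  define m where "m A = nat \<lfloor>A powr \<sigma> / (2 * k)\<rfloor>" for A :: real
  have m: "real (m A) \<le> A powr \<sigma> / (2 * k)" "A powr \<sigma> / (2 * k) - 1 \<le> real (m A)" for A
    unfolding m_def using k by (auto simp: of_nat_nat)
  have "\<sigma> < 1" "0 < \<sigma>" "\<kappa> < \<sigma>" "0 < \<kappa>" "\<tau> < 1" using ord q by auto
  note \<sigma> = this
  have E1: "\<forall>\<^sub>F A::real in at_top. 4 \<le> A" by real_asymp
  have E2: "\<forall>\<^sub>F A::real in at_top. A powr \<sigma> \<le> A / 2" using \<sigma> by real_asymp
  have E3: "\<forall>\<^sub>F A::real in at_top. 4 \<le> e\<^sup>2 * (c\<^sup>2 * ln (A / 2) / l\<^sup>2)"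
  proof -
    have "0 < e\<^sup>2 * c\<^sup>2 / l\<^sup>2" using e c l by simp
    then have "\<forall>\<^sub>F A::real in at_top. 4 \<le> e\<^sup>2 * c\<^sup>2 / l\<^sup>2 * ln (A / 2)" by real_asymp
    then show ?thesis by (simp add: mult.assoc)
  qed
  \<comment> \<open>The factor \<open>exp (k / 2)\<close> pays for rounding the number of times
    down: \<open>sqrt (e ^ m A)\<close> is at most
    \<open>exp (k / 2 - A powr \<sigma> / 4)\<close>.\<close>
  have E4: "\<forall>\<^sub>F A::real in at_top. K * exp (k / 2) * (ln A * exp (- (A powr \<sigma> / 4))) \<le> e\<^sup>2 / 40"
  proof -
    have "((\<lambda>A. ln A * exp (- (A powr \<sigma> / 4))) \<longlongrightarrow> 0) at_top" using \<sigma> by real_asymp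
    then have "((\<lambda>A. K * exp (k / 2) * (ln A * exp (- (A powr \<sigma> / 4)))) \<longlongrightarrow> K * exp (k / 2) * 0) at_top"
      by (intro tendsto_intros)
    then have "\<forall>\<^sub>F A in at_top. K * exp (k / 2) * (ln A * exp (- (A powr \<sigma> / 4))) < e\<^sup>2 / 40"
      using e by (intro order_tendstoD(2)) auto
    then show ?thesis by eventually_elim simp
  qed
  have E5: "\<forall>\<^sub>F A::real in at_top. ln (1 / \<delta>) \<le> (A powr \<sigma> / (2 * k) - 1) * exp (- (\<kappa> * ln A))"
  proof -
    have "filterlim (\<lambda>A::real. (A powr \<sigma> / (2 * k) - 1) * exp (- (\<kappa> * ln A))) at_top at_top"
      using \<sigma> k by real_asymp
    then show ?thesis by (simp add: filterlim_at_top)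
  qed
  have E6: "\<forall>\<^sub>F A::real in at_top. exp (- (A / 2)) < T"
  proof -
    have "((\<lambda>A::real. exp (- (A / 2))) \<longlongrightarrow> 0) at_top" by real_asymp
    then show ?thesis using T by (rule order_tendstoD(2))
  qed
  have E7: "\<forall>\<^sub>F A in at_top. 0 < h (exp A * exp (- (A powr \<sigma>))) \<and>
      h (exp A) \<le> (1 + e) * h (exp A * exp (- (A powr \<sigma>)))"
    using \<sigma> ord e by (intro class_H_comparison[OF h, of \<sigma> \<tau> e]) auto
  have lim: "filterlim (\<lambda>t::real. ln (1 / t)) at_top (at_right 0)" by real_asymp
  have pos: "\<forall>\<^sub>F t in at_right 0. 0 < (t::real)" by (simp add: eventually_at_right_less)
  have ev: "\<forall>\<^sub>F t in at_right 0. 0 < t \<and> (\<exists>A. A = ln (1 / t) \<and>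
      4 \<le> A \<and> A powr \<sigma> \<le> A / 2 \<and> 4 \<le> e\<^sup>2 * (c\<^sup>2 * ln (A / 2) / l\<^sup>2) \<and>
      K * exp (k / 2) * (ln A * exp (- (A powr \<sigma> / 4))) \<le> e\<^sup>2 / 40 \<and>
      ln (1 / \<delta>) \<le> (A powr \<sigma> / (2 * k) - 1) * exp (- (\<kappa> * ln A)) \<and> exp (- (A / 2)) < T \<and>
      0 < h (exp A * exp (- (A powr \<sigma>))) \<and> h (exp A) \<le> (1 + e) * h (exp A * exp (- (A powr \<sigma>))))"
    using pos eventually_compose_filterlim[OF eventually_conj[OF E1 eventually_conj[OF E2 eventually_conj[OF E3
      eventually_conj[OF E4 eventually_conj[OF E5 eventually_conj[OF E6 E7]]]]]] lim]
    by eventually_elim simp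
  \<comment> \<open>The bound on \<open>V\<close> holds for some \<open>t\<close> arbitrarily near
    0, everything else for all small \<open>t\<close>; one common \<open>t\<close> suffices.\<close>
  from frequently_ex[OF frequently_eventually_frequently[OF V[OF l \<open>l < lam\<close>] ev]]
  obtain t A where t: "0 < t" and A: "A = ln (1 / t)" and A4: "4 \<le> A" and w: "A powr \<sigma> \<le> A / 2"
    and large: "4 \<le> e\<^sup>2 * (c\<^sup>2 * ln (A / 2) / l\<^sup>2)"
    and small: "K * exp (k / 2) * (ln A * exp (- (A powr \<sigma> / 4))) \<le> e\<^sup>2 / 40"
    and many: "ln (1 / \<delta>) \<le> (A powr \<sigma> / (2 * k) - 1) * exp (- (\<kappa> * ln A))"
    and AT: "exp (- (A / 2)) < T"
    and hpos: "0 < h (exp A * exp (- (A powr \<sigma>)))"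
    and hle: "h (exp A) \<le> (1 + e) * h (exp A * exp (- (A powr \<sigma>)))"
    and Vt: "l\<^sup>2 / 2 < V_fun L (sqrt (t * ln (ln (1 / t))) / h (1 / t)) * (h (1 / t))\<^sup>2"
    by blast
  have eA: "exp A = 1 / t" using t by (simp add: A)
  define n where "n = m A"
  define s where "s j = t * (1 / e) ^ (n + j)" for j
  have nw: "real n * (2 * k) \<le> A powr \<sigma>" using m(1)[of A] k by (simp add: n_def field_simps)
  have pow: "(1 / e) ^ (2 * n) \<le> exp (A powr \<sigma>)"
    unfolding ek(1) exp_of_nat_mult[symmetric] using nw by (simp add: mult_ac)
  have sq: "sqrt (e ^ n) \<le> exp (k / 2) * exp (- (A powr \<sigma> / 4))"
  proof -
    have "A powr \<sigma> - 2 * k \<le> real n * (2 * k)"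
      using mult_right_mono[OF m(2)[of A], of "2 * k"] k by (simp add: n_def left_diff_distrib)
    then have "- (real n * k / 2) \<le> k / 2 - A powr \<sigma> / 4" by (simp add: field_simps)
    then have "exp (- (real n * k / 2)) \<le> exp (k / 2) * exp (- (A powr \<sigma> / 4))"
      by (simp add: exp_add[symmetric])
    moreover have "e ^ n = (exp (- (real n * k / 2)))\<^sup>2"
      unfolding ek(2) by (simp add: exp_of_nat_mult[symmetric] exp_double[symmetric])
    ultimately show ?thesis by simp
  qed
  have small': "6 * c * (1 + e) / ((1 - e) * l\<^sup>2) * (ln A * sqrt (e ^ n)) \<le> e\<^sup>2 / 40"
  proof -
    have "K * (ln A * sqrt (e ^ n)) \<le> K * (ln A * (exp (k / 2) * exp (- (A powr \<sigma> / 4))))"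
      using K A4 sq by (intro mult_left_mono) auto
    also have "\<dots> = K * exp (k / 2) * (ln A * exp (- (A powr \<sigma> / 4)))" by simp
    finally show ?thesis using small unfolding K_def by linarith
  qed
  have "1 - exp (- (real n * exp (- (\<kappa> * ln A)))) \<le> measure M {\<omega> \<in> space M. \<exists>j\<le>n.
      c0 \<le> h (1 / s j) * norm (X (s j) \<omega>) / sqrt (s j * ln (ln (1 / s j)))}"
    unfolding s_def A
    by (rule levy_block_probability[OF lp _ c0(1) l e t, where w="A powr \<sigma>"])
      (use h A4 w pow hpos hle Vt large small' in \<open>auto simp: A[symmetric] eA class_H_def class_H1_def\<close>)
  moreover have "exp (- (real n * exp (- (\<kappa> * ln A)))) \<le> \<delta>"
  proof -
    have "(A powr \<sigma> / (2 * k) - 1) * exp (- (\<kappa> * ln A)) \<le> real n * exp (- (\<kappa> * ln A))"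
      unfolding n_def by (intro mult_right_mono m) simp
    moreover have "ln (1 / \<delta>) = - ln \<delta>" using \<delta> by (simp add: ln_div)
    ultimately have "- (real n * exp (- (\<kappa> * ln A))) \<le> ln \<delta>"
      using many by linarith
    then have "exp (- (real n * exp (- (\<kappa> * ln A)))) \<le> exp (ln \<delta>)" by simp
    then show ?thesis using \<delta> by simp
  qed
  ultimately have P: "1 - \<delta> \<le> measure M {\<omega> \<in> space M. \<exists>s\<in>s ` {..n}. c0 \<le> h (1 / s) * norm (X s \<omega>) / sqrt (s * ln (ln (1 / s)))}"
    by (simp add: Bex_def)
  show thesis
  proof (rule that[OF _ _ P])
    show "s ` {..n} \<subseteq> {0<..<T}"
    proof safe
      fix j assume "j \<le> n"
      have "0 < s j" using t e by (simp add: s_def)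
      moreover have "s j < T"
      proof -
        have "(1 / e) ^ (n + j) \<le> (1 / e) ^ (2 * n)"
          using \<open>j \<le> n\<close> e by (intro power_increasing) auto
        then have "s j \<le> t * exp (A powr \<sigma>)"
          unfolding s_def using t pow by (intro mult_left_mono) auto
        also have "\<dots> \<le> t * exp (A / 2)" using t w by simp
        also have "t = exp (- A)" using eA t by (simp add: exp_minus field_simps)
        also have "exp (- A) * exp (A / 2) = exp (- (A / 2))" by (simp add: exp_add[symmetric])
        finally show ?thesis using AT by simp
      qed
      ultimately show "s j \<in> {0<..<T}" by simp
    qed
  qed simp
qed

text \<open>The hit events belong to finite sets of times and fail with probability at most
  \<open>1 / (n + 1)\<close>; their union over \<open>n\<close> is measurable, contains each of
  them, and therefore has probability one.\<close>

lemma levy_hit_almost_surely: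
  fixes X :: "real \<Rightarrow> 'w \<Rightarrow> real^'n" and h :: "real \<Rightarrow> real" and q lam c0 T :: real
  assumes lp: "levy_process M X \<gamma> 0 L" and "0 \<le> q" "q < 1" "class_H q h"
    and "0 < lam" "0 < c0" "c0 < sqrt (1 - q) * lam" "0 < T"
    and V: "\<And>l. 0 < l \<Longrightarrow> l < lam \<Longrightarrow>
      \<exists>\<^sub>F t in at_right 0. l\<^sup>2 / 2 < V_fun L (sqrt (t * ln (ln (1 / t))) / h (1 / t)) * (h (1 / t))\<^sup>2"
  shows "AE \<omega> in M. \<exists>s. 0 < s \<and> s < T \<and> c0 \<le> h (1 / s) * norm (X s \<omega>) / sqrt (s * ln (ln (1 / s)))"
proof -
  interpret prob_space M using lp by (simp add: levy_process_def)
  define G where "G S = {\<omega> \<in> space M. \<exists>s\<in>S. c0 \<le> h (1 / s) * norm (X s \<omega>) / sqrt (s * ln (ln (1 / s)))}" for S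
  have "\<exists>S. finite S \<and> S \<subseteq> {0<..<T} \<and> 1 - 1 / real (Suc n) \<le> prob (G S)" for n
    unfolding G_def
    by (rule levy_hit_probability[OF assms(1-8) _ V, of "1 / real (Suc n)"]) (simp, assumption+, blast)
  then obtain S where S: "\<And>n. finite (S n)" "\<And>n. S n \<subseteq> {0<..<T}" "\<And>n. 1 - 1 / real (Suc n) \<le> prob (G (S n))"
    by metis
  have G[measurable]: "G (S n) \<in> events" for n
  proof -
    have X: "\<forall>s\<ge>0. X s \<in> borel_measurable M"
      using lp unfolding levy_process_def by (elim conjE)
    have ev: "{\<omega> \<in> space M. c0 \<le> h (1 / s) * norm (X s \<omega>) / sqrt (s * ln (ln (1 / s)))} \<in> events"
      if "s \<in> S n" for s
    proof -
      have "0 \<le> s" using S(2)[of n] that by auto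
      then have [measurable]: "X s \<in> borel_measurable M" using X by blast
      show ?thesis by measurable
    qed
    have "G (S n) = (\<Union>s\<in>S n. {\<omega> \<in> space M. c0 \<le> h (1 / s) * norm (X s \<omega>) / sqrt (s * ln (ln (1 / s)))})"
      by (auto simp: G_def)
    then show ?thesis using S(1)[of n] ev by (simp only: sets.finite_UN)
  qed
  have "1 - 1 / real (Suc n) \<le> prob (\<Union>n. G (S n))" for n
    by (rule order_trans[OF S(3) finite_measure_mono]) (rule UN_upper, simp, measurable)
  then have "1 - 0 \<le> prob (\<Union>n. G (S n))"
    by (intro LIMSEQ_le_const2[OF tendsto_diff[OF tendsto_const LIMSEQ_Suc[OF lim_1_over_n]]]) auto
  then have "prob (\<Union>n. G (S n)) = 1" using prob_le_1[of "\<Union>n. G (S n)"] by linarith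
  then have "AE \<omega> in M. \<omega> \<in> (\<Union>n. G (S n))" by (intro AE_prob_1)
  then show ?thesis
  proof eventually_elim
    case (elim \<omega>)
    then obtain n s where "s \<in> S n" "c0 \<le> h (1 / s) * norm (X s \<omega>) / sqrt (s * ln (ln (1 / s)))"
      by (auto simp: G_def)
    then show ?case using S(2)[of n] by (intro exI[of _ s]) auto
  qed
qed

section \<open>The almost sure limit superior\<close>

lemma frequently_imp_le_Limsup:
  fixes f :: "'a \<Rightarrow> 'b::complete_lattice"
  assumes "\<exists>\<^sub>F x in F. c \<le> f x"
  shows "c \<le> Limsup F f"
  unfolding Limsup_def
proof (rule INF_greatest)
  fix P assume "P \<in> {P. eventually P F}"
  then have "\<exists>\<^sub>F x in F. c \<le> f x \<and> P x"
    using frequently_eventually_frequently[OF assms] by simp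
  then obtain x where "P x" "c \<le> f x" by (auto dest: frequently_ex)
  then show "c \<le> Sup (f ` Collect P)" by (auto intro: SUP_upper2)
qed

theorem theorem2p2:
  fixes M :: "'w measure" and X :: "real \<Rightarrow> 'w \<Rightarrow> real^'n"
    and \<gamma> :: "real^'n" and Lm :: "(real^'n) measure"
    and h :: "real \<Rightarrow> real" and q lam :: real and b :: "real \<Rightarrow> real"
  assumes "levy_process M X \<gamma> 0 Lm"
    and "0 \<le> lam"
    and "0 \<le> q" and "q \<le> 1"
    and "class_H q h"
    and "\<And>t. b t = sqrt (t * ln (ln (1 / t))) / h (1 / t)"
    and "Limsup (at_right 0) (\<lambda>t. ereal (V_fun Lm (b t) * (h (1 / t))^2)) \<ge> ereal (lam^2 / 2)"
  shows "AE \<omega> in M. Limsup (at_right 0)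
           (\<lambda>t. ereal (h (1 / t) * norm (X t \<omega>) / sqrt (t * ln (ln (1 / t)))))
         \<ge> ereal (sqrt (1 - q) * lam)"
proof (cases "lam = 0 \<or> q = 1")
  case True
  have h0: "0 \<le> h x" if "0 \<le> x" for x using assms(5) that by (simp add: class_H_def class_H1_def)
  \<comment> \<open>In these degenerate cases the claimed bound is 0, and near 0 the quotient is
    nonnegative because the iterated logarithm is positive there.\<close>
  have "0 \<le> Limsup (at_right 0) (\<lambda>t. ereal (h (1 / t) * norm (X t \<omega>) / sqrt (t * ln (ln (1 / t)))))" for \<omega>
  proof (rule le_Limsup)
    have "\<forall>\<^sub>F t::real in at_right 0. 0 < t \<and> 0 \<le> t * ln (ln (1 / t))"
      by (intro eventually_conj) real_asymp+
    then show "\<forall>\<^sub>F t in at_right 0. 0 \<le> ereal (h (1 / t) * norm (X t \<omega>) / sqrt (t * ln (ln (1 / t))))"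
      by eventually_elim (auto intro!: h0 divide_nonneg_nonneg mult_nonneg_nonneg)
  qed simp
  then show ?thesis using True by (auto simp: zero_ereal_def)
next
  case False
  then have lam: "0 < lam" and q: "q < 1" using assms by auto
  have V: "\<exists>\<^sub>F t in at_right 0. l\<^sup>2 / 2 < V_fun Lm (sqrt (t * ln (ln (1 / t))) / h (1 / t)) * (h (1 / t))\<^sup>2"
    if "0 < l" "l < lam" for l
  proof -
    have "l\<^sup>2 < lam\<^sup>2" using that by (intro power_strict_mono) auto
    then have less: "ereal (l\<^sup>2 / 2) < ereal (lam\<^sup>2 / 2)" by simp
    have "\<exists>\<^sub>F t in at_right 0. ereal (l\<^sup>2 / 2) < ereal (V_fun Lm (b t) * (h (1 / t))^2)"
    proof (rule ccontr)
      assume "\<not> ?thesis"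
      then have "\<forall>\<^sub>F t in at_right 0. ereal (V_fun Lm (b t) * (h (1 / t))^2) \<le> ereal (l\<^sup>2 / 2)"
        by (simp add: not_frequently not_less)
      then have "Limsup (at_right 0) (\<lambda>t. ereal (V_fun Lm (b t) * (h (1 / t))^2)) \<le> ereal (l\<^sup>2 / 2)"
        by (rule Limsup_bounded)
      with assms(7) less show False by (meson leD order_trans)
    qed
    then show ?thesis by (simp add: assms(6))
  qed
  define C where "C = sqrt (1 - q) * lam"
  have C: "0 < C" using lam q by (simp add: C_def)
  \<comment> \<open>Hits are available at levels strictly below \<open>C\<close>; countably many
    levels \<open>c n\<close> and bounds \<open>1 / real (Suc k)\<close> on the time share one null
    set. The shift by 2 makes \<open>c 0\<close> positive.\<close>
  define c where "c n = C * (1 - 1 / real (n + 2))" for n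
  have c: "0 < c n" "c n < C" for n
  proof -
    have "0 < 1 - 1 / real (n + 2)" "1 - 1 / real (n + 2) < 1" by auto
    then show "0 < c n" "c n < C"
      using mult_pos_pos[OF C] mult_strict_left_mono[OF _ C, of "1 - 1 / real (n + 2)" 1] by (simp_all add: c_def)
  qed
  have "AE \<omega> in M. \<forall>n k. \<exists>s. 0 < s \<and> s < 1 / real (Suc k) \<and> c n \<le> h (1 / s) * norm (X s \<omega>) / sqrt (s * ln (ln (1 / s)))"
    unfolding AE_all_countable
    using levy_hit_almost_surely[OF assms(1) assms(3) q assms(5) lam c(1) c(2)[unfolded C_def] _ V] by simp
  then show ?thesis
  proof eventually_elim
    case (elim \<omega>)
    define F where "F t = h (1 / t) * norm (X t \<omega>) / sqrt (t * ln (ln (1 / t)))" for t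
    have freq: "\<exists>\<^sub>F t in at_right 0. c n \<le> F t" for n
    proof (rule ccontr)
      assume "\<not> ?thesis"
      then have "\<forall>\<^sub>F t in at_right 0. \<not> c n \<le> F t" by (simp add: not_frequently)
      then obtain d where d: "0 < d" "\<And>t. 0 < t \<Longrightarrow> t < d \<Longrightarrow> \<not> c n \<le> F t"
        by (auto simp: eventually_at_right_field)
      obtain k where "1 / real (Suc k) < d" using d(1) nat_approx_posE by blast
      with elim d(2) show False unfolding F_def by (meson order_less_trans)
    qed
    have "(\<lambda>n. ereal (c n)) \<longlonglongrightarrow> ereal C"
    proof -
      have "c \<longlonglongrightarrow> C" unfolding c_def by real_asymp
      then show ?thesis by simp
    qed
    then have "ereal C \<le> Limsup (at_right 0) (\<lambda>t. ereal (F t))"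
      by (rule LIMSEQ_le_const2) (use freq in \<open>auto intro!: frequently_imp_le_Limsup\<close>)
    then show ?case by (simp add: C_def F_def)
  qed
qed

end
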